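(* Let $n$ be a positive odd integer and $a$ an indeterminate. Then, modulo $\Phi_{n}(q)(1-aq^{n})(a-q^{n})$, \[ \sum_{k=0}^{(n-1)/2}[6k+1]\frac{(q;q^{4})_{k}(q;q^{2})_{k}(aq,q/a;q^{2})_{k}}{(q^{2};q^{2})_{k}(q^{4};q^{4})_{k}(aq^{4},q^{4}/a;q^{4})_{k}}q^{k^{2}+k} \equiv \begin{cases} \dfrac{(q^{2};q^{4})_{(n-1)/4}}{(q^{4};q^{4})_{(n-1)/4}}[n]\,q^{(1-n)/4}, & \text{if } n\equiv 1 \pmod 4,\\[6pt] 0, & \text{if } n\equiv 3 \pmod 4. \end{cases} \]
   Context: For an indeterminate $q$, $(x;q)_k=(1-x)(1-xq)\cdots(1-xq^{k-1})$ (with $(x;q)_0=1$), and $(x_1,\dots,x_m;q)_k=(x_1;q)_k\cdots(x_m;q)_k$. $[m]=(1-q^m)/(1-q)$ is the $q$-integer and $\Phi_n(q)$ is the $n$-th cyclotomic polynomial. A congruence between rational functions in $q$ and $a$ modulo a polynomial $P(q,a)$ means that the difference is $P(q,a)$ times a rational function in $q,a$ whose denominator is coprime to $P(q,a)$. *)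

theory Defs
  imports Complex_Main "HOL-Computational_Algebra.Computational_Algebra"
begin

definition q_pochhammer :: "'a::comm_ring_1 \<Rightarrow> 'a \<Rightarrow> nat \<Rightarrow> 'a" where
  "q_pochhammer x q k = (\<Prod>i<k. 1 - x * q ^ i)"

definition q_integer :: "'a::field \<Rightarrow> nat \<Rightarrow> 'a" where
  "q_integer q m = (1 - q ^ m) / (1 - q)"


definition primitive_roots_unity :: "nat \<Rightarrow> complex set" where
  "primitive_roots_unity n = {z. z ^ n = 1 \<and> (\<forall>k. 0 < k \<and> k < n \<longrightarrow> z ^ k \<noteq> 1)}"

text \<open>
  The polynomial with the primitive \<open>n\<close>-th roots of unity as simple roots has rational
  coefficients; \<open>map_poly_cyclotomic\<close> below shows that the description is proper for \<open>n > 0\<close>.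
\<close>
definition cyclotomic :: "nat \<Rightarrow> rat poly" where
  "cyclotomic n =
     (THE p. map_poly of_rat p = (\<Prod>z\<in>primitive_roots_unity n. [:- z, 1:]))"

lemma finite_primitive_roots_unity: "n > 0 \<Longrightarrow> finite (primitive_roots_unity n)"
  by (rule finite_subset[OF _ finite_roots_unity[of n]]) (auto simp: primitive_roots_unity_def)

lemma UN_primitive_roots_unity:
  assumes "n > 0"
  shows "(\<Union>d\<in>{d. d dvd n}. primitive_roots_unity d) = {z. z ^ n = 1}"
proof (intro equalityI subsetI)
  fix z assume "z \<in> (\<Union>d\<in>{d. d dvd n}. primitive_roots_unity d)"
  then show "z \<in> {z. z ^ n = 1}"
    by (auto simp: primitive_roots_unity_def power_mult elim!: dvdE)
next
  fix z :: complex assume "z \<in> {z. z ^ n = 1}"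
  then have z: "z ^ n = 1" by simp
  define d where "d = (LEAST d. d > 0 \<and> z ^ d = 1)"
  have d: "d > 0 \<and> z ^ d = 1"
    unfolding d_def by (rule LeastI[of _ n]) (use assms z in auto)
  have least: "z ^ k \<noteq> 1" if "0 < k" "k < d" for k
    using not_less_Least[of k "\<lambda>d. d > 0 \<and> z ^ d = 1"] that unfolding d_def by auto
  have "z ^ n = z ^ (d * (n div d) + n mod d)" by simp
  also have "\<dots> = z ^ (n mod d)" using d by (simp only: power_add power_mult) simp
  finally have "z ^ (n mod d) = 1" using z by simp
  with least[of "n mod d"] d have "d dvd n" by (auto simp: dvd_eq_mod_eq_0)
  with d least show "z \<in> (\<Union>d\<in>{d. d dvd n}. primitive_roots_unity d)"
    by (auto simp: primitive_roots_unity_def)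
qed

lemma disjoint_primitive_roots_unity:
  assumes "m > 0" "n > 0" "m \<noteq> n"
  shows "primitive_roots_unity m \<inter> primitive_roots_unity n = {}"
proof (cases "m < n")
  case True
  then show ?thesis using assms by (auto simp: primitive_roots_unity_def)
next
  case False
  then have "n < m" using assms by simp
  then show ?thesis using assms by (auto simp: primitive_roots_unity_def)
qed

lemma prod_roots_unity:
  assumes "n > 0"
  shows "(\<Prod>z | z ^ n = 1. [:- z, 1:]) = monom 1 n - (1 :: complex poly)" (is "?p = ?q")
proof (rule ccontr)
  assume "?p \<noteq> ?q"
  let ?S = "{z :: complex. z ^ n = 1}"
  have fin: "finite ?S" using assms by (intro finite_roots_unity) auto
  have card: "card ?S = n" using card_roots_unity_eq[OF assms] .
  have deg_p: "degree ?p = n" using card by (simp add: degree_prod_sum_eq)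
  have "lead_coeff ?p = 1" by (simp add: lead_coeff_prod)
  then have c: "coeff (?p - ?q) n = 0" using deg_p assms by simp
  have "degree (?p - ?q) \<le> n"
    using deg_p by (intro degree_diff_le) (auto simp: degree_monom_le)
  with c \<open>?p \<noteq> ?q\<close> have less: "degree (?p - ?q) < n"
    by (metis assms eq_zero_or_degree_less right_minus_eq)
  have sub: "?S \<subseteq> {z. poly (?p - ?q) z = 0}"
    using fin by (auto simp: poly_prod poly_monom)
  have ne: "?p - ?q \<noteq> 0" using \<open>?p \<noteq> ?q\<close> by simp
  have "n \<le> card {z. poly (?p - ?q) z = 0}"
    using card_mono[OF poly_roots_finite[OF ne] sub] card by simp
  also have "\<dots> \<le> degree (?p - ?q)" by (rule card_poly_roots_bound[OF ne])
  finally show False using less by simp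
qed

lemma map_poly_of_rat_mult:
  "map_poly (of_rat :: rat \<Rightarrow> complex) (p * q) = map_poly of_rat p * map_poly of_rat q"
  by (intro poly_eqI) (simp add: coeff_map_poly coeff_mult of_rat_sum of_rat_mult)

lemma map_poly_of_rat_add:
  "map_poly (of_rat :: rat \<Rightarrow> complex) (p + q) = map_poly of_rat p + map_poly of_rat q"
  by (intro poly_eqI) (simp add: coeff_map_poly of_rat_add)

lemma map_poly_of_rat_prod:
  "map_poly (of_rat :: rat \<Rightarrow> complex) (\<Prod>x\<in>A. f x) = (\<Prod>x\<in>A. map_poly of_rat (f x))"
  by (induction A rule: infinite_finite_induct) (simp_all add: map_poly_of_rat_mult)

lemma inj_map_poly_of_rat: "inj (map_poly (of_rat :: rat \<Rightarrow> complex))"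
  by (rule injI) (metis coeff_map_poly of_rat_0 of_rat_eq_iff poly_eqI)

lemma ex_rat_cyclotomic:
  assumes "n > 0"
  shows "\<exists>p. map_poly of_rat p = (\<Prod>z\<in>primitive_roots_unity n. [:- z, 1:])"
  using assms
proof (induction n rule: less_induct)
  case (less n)
  let ?C = "\<lambda>d. \<Prod>z\<in>primitive_roots_unity d. [:- z, 1:]"
  let ?D = "{d. d dvd n} - {n}"
  have fin: "finite {d. d dvd n}" using less.prems by simp
  have "\<forall>d\<in>?D. \<exists>p. map_poly of_rat p = ?C d"
  proof
    fix d assume d: "d \<in> ?D"
    then have "d \<le> n" "d > 0" using less.prems by (auto intro: dvd_imp_le Nat.gr0I)
    then show "\<exists>p. map_poly of_rat p = ?C d" using d by (intro less.IH) auto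
  qed
  then obtain f where f: "\<And>d. d \<in> ?D \<Longrightarrow> map_poly of_rat (f d) = ?C d" by metis
  define b where "b = (\<Prod>d\<in>?D. f d)"
  let ?B = "map_poly of_rat b :: complex poly"
  have B: "?B = (\<Prod>d\<in>?D. ?C d)" unfolding b_def map_poly_of_rat_prod using f by simp
  have B0: "?B \<noteq> 0"
  proof -
    have "lead_coeff (?C d) = 1" for d by (simp add: lead_coeff_prod)
    then have "lead_coeff (\<Prod>d\<in>?D. ?C d) = 1" unfolding lead_coeff_prod by simp
    then show ?thesis unfolding B by (metis leading_coeff_0_iff zero_neq_one)
  qed
  then have b0: "b \<noteq> 0" by auto
  have "monom 1 n - 1 = (\<Prod>z | z ^ n = 1. [:- z, 1:] :: complex poly)"
    using prod_roots_unity[OF less.prems] by simp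
  also have "\<dots> = (\<Prod>d | d dvd n. ?C d)"
    unfolding UN_primitive_roots_unity[OF less.prems, symmetric]
    using less.prems
    by (intro prod.UNION_disjoint fin ballI finite_primitive_roots_unity impI
          disjoint_primitive_roots_unity) (auto intro: Nat.gr0I)
  also have "\<dots> = ?C n * ?B" unfolding B using fin by (intro prod.remove) auto
  finally have eq: "monom 1 n - 1 = ?C n * ?B" .
  define m where "m = monom 1 n - (1 :: rat poly)"
  have M: "map_poly of_rat m = (monom 1 n - 1 :: complex poly)"
    unfolding m_def by (intro poly_eqI) (simp add: coeff_map_poly of_rat_diff coeff_1)
  let ?Q = "map_poly of_rat (m div b) :: complex poly"
  let ?R = "map_poly of_rat (m mod b) :: complex poly"
  have "map_poly of_rat m = ?Q * ?B + ?R"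
    by (simp flip: map_poly_of_rat_mult map_poly_of_rat_add)
  then have R: "?R = (?C n - ?Q) * ?B" using M eq by (simp add: algebra_simps)
  have "?C n = ?Q"
  proof (rule ccontr)
    assume "?C n \<noteq> ?Q"
    then have nz: "?C n - ?Q \<noteq> 0" by simp
    then have "?R \<noteq> 0" using R B0 by simp
    then have "m mod b \<noteq> 0" by auto
    then have "degree (m mod b) < degree b" using b0 degree_mod_less by blast
    moreover have "degree ?R = degree (?C n - ?Q) + degree ?B"
      unfolding R using nz B0 by (rule degree_mult_eq)
    ultimately show False by (simp add: degree_map_poly)
  qed
  then show ?case by metis
qed

lemma map_poly_cyclotomic:
  assumes "n > 0"
  shows "map_poly of_rat (cyclotomic n) = (\<Prod>z\<in>primitive_roots_unity n. [:- z, 1:])"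
  unfolding cyclotomic_def
  by (rule theI') (metis ex_rat_cyclotomic[OF assms] injD[OF inj_map_poly_of_rat])


text \<open>
  \<open>\<rat>[q, a]\<close> is represented as \<open>\<rat>[q][a]\<close>, and \<open>\<rat>(q, a)\<close> as its field of fractions.
\<close>
definition q_var :: "rat poly poly" where
  "q_var = [:[:0, 1:]:]"

definition a_var :: "rat poly poly" where
  "a_var = [:0, 1:]"

definition ratfun_cong :: "rat poly poly fract \<Rightarrow> rat poly poly fract \<Rightarrow> rat poly poly \<Rightarrow> bool" where
  "ratfun_cong f g P \<longleftrightarrow>
     (\<exists>N D. D \<noteq> 0 \<and> coprime D P \<and> f - g = to_fract P * Fract N D)"

end

theory Submission
  imports Defs "HOL-Computational_Algebra.Field_as_Ring"
begin

text \<open>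
  Put \<open>p = q^2\<close>, \<open>A = q\<close>, \<open>b = a q\<close>, \<open>c = q / a\<close>, so that \<open>b c = p\<close>. Up to the factor \<open>1 - q\<close> the
  summand is
  \<open>(1 - A p^(3k)) (A;p^2)_k (A,b,c;p)_k p^(k(k+1)/2) / ((p;p)_k (p^2,Abp,Acp;p^2)_k)\<close>,
  and it satisfies two first-order telescoping relations, one for \<open>A \<rightarrow> A / p^2\<close> and one for
  \<open>(b, c) \<rightarrow> (b / p^2, c p^2)\<close>. The second one evaluates the sum when \<open>b\<close> or \<open>c\<close> equals
  \<open>p^(-(n-1)/2)\<close>, that is, for \<open>a = q^n\<close> and \<open>a = q^(-n)\<close>. The first one shows that the sum
  vanishes for \<open>A = p^(-N)\<close>; a primitive \<open>n\<close>-th root of unity \<open>q\<close> satisfies \<open>q = p^(-(n-1)/2)\<close>,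
  hence the sum vanishes modulo the \<open>n\<close>-th cyclotomic polynomial.

  The congruence itself is tested by ring homomorphisms from \<open>\<rat>[q, a]\<close> to \<open>\<complex>(t)\<close>: \<open>q\<close> goes to \<open>t\<close> and
  \<open>a\<close> to \<open>t^n\<close> or \<open>t^(-n)\<close>, or \<open>q\<close> goes to a primitive \<open>n\<close>-th root of unity and \<open>a\<close> to \<open>t\<close>. A polynomial
  killed by all of them is divisible by the modulus, and one killed by none is coprime to it.
\<close>

section \<open>Two telescoping relations\<close>

lemma q_pochhammer_0 [simp]: "q_pochhammer x q 0 = 1"
  by (simp add: q_pochhammer_def)

lemma q_pochhammer_Suc: "q_pochhammer x q (Suc k) = q_pochhammer x q k * (1 - x * q ^ k)"
  by (simp add: q_pochhammer_def)

lemma q_pochhammer_shift: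
  "(1 - x) * q_pochhammer (x * q) q k = q_pochhammer x q k * (1 - x * q ^ k)"
proof (induction k)
  case (Suc k)
  have "(1 - x) * q_pochhammer (x * q) q (Suc k) =
      ((1 - x) * q_pochhammer (x * q) q k) * (1 - x * q ^ Suc k)"
    by (simp add: q_pochhammer_Suc mult_ac)
  also have "\<dots> = q_pochhammer x q (Suc k) * (1 - x * q ^ Suc k)"
    unfolding Suc by (simp add: q_pochhammer_Suc)
  finally show ?case .
qed simp

lemma q_pochhammer_eq_0_iff:
  "q_pochhammer (x :: 'a :: idom) q k = 0 \<longleftrightarrow> (\<exists>i<k. x * q ^ i = 1)"
  by (auto simp: q_pochhammer_def)

lemma q_pochhammer_nonzero:
  "(\<And>i. i < k \<Longrightarrow> x * q ^ i \<noteq> 1) \<Longrightarrow> q_pochhammer (x :: 'a :: idom) q k \<noteq> 0"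
  by (auto simp: q_pochhammer_eq_0_iff)

lemma triangular_Suc: "Suc k * (Suc k + 1) div 2 = k * (k + 1) div 2 + Suc k"
proof -
  have "Suc k * (Suc k + 1) = k * (k + 1) + 2 * Suc k" by simp
  thus ?thesis by (metis div_mult_self2 zero_neq_numeral add.commute)
qed

text \<open>The factor \<open>1 - A * p ^ (3 * k)\<close> is split off because both certificates are
  multiples of the bare weight. The product of \<open>b\<close> and \<open>c\<close> is left free:
  the second telescoping relation uses a weight with product 1/p instead of p.\<close>

definition cubic_weight :: "'a::field \<Rightarrow> 'a \<Rightarrow> 'a \<Rightarrow> 'a \<Rightarrow> nat \<Rightarrow> 'a" where
  "cubic_weight A p b c k =
     (q_pochhammer A (p ^ 2) k * q_pochhammer A p k * (q_pochhammer b p k * q_pochhammer c p k)) /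
     (q_pochhammer p p k * q_pochhammer (p ^ 2) (p ^ 2) k *
       (q_pochhammer (A * b * p) (p ^ 2) k * q_pochhammer (A * c * p) (p ^ 2) k)) *
     p ^ (k * (k + 1) div 2)"

definition cubic_term :: "'a::field \<Rightarrow> 'a \<Rightarrow> 'a \<Rightarrow> 'a \<Rightarrow> nat \<Rightarrow> 'a" where
  "cubic_term A p b c k = (1 - A * p ^ (3 * k)) * cubic_weight A p b c k"

lemma cubic_weight_commute: "cubic_weight A p b c k = cubic_weight A p c b k"
  by (simp add: cubic_weight_def mult_ac)

lemma cubic_term_commute: "cubic_term A p b c = cubic_term A p c b"
  by (rule ext) (simp add: cubic_term_def cubic_weight_commute[of A p b])

text \<open>This is the first telescoping relation after division by the weight and clearing of
  denominators, with \<open>x\<close> for p^k. Writing p as \<open>b * c\<close> makes it an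
  unconditional polynomial identity.\<close>

lemma telescope_A_poly:
  fixes A b c x :: "'a::field"
  shows "A * ((1 - A * x) * (1 - b * x) * (1 - c * x) * (1 - A * x^2) * (b * c * x)
      - (1 - x^2) * (1 - x) * (1 - A * b * (b * c) * x^2) * (1 - A * c * (b * c) * x^2))
    = (1 - A) * (1 - A * x^3) * (1 - A * b * (b * c) * x^2) * (1 - A * c * (b * c) * x^2)
      - (1 - A * (b * c)^2 * x^3) * (1 - A * x) * (1 - A * (b * c) * x) * (1 - A * x^2)"
  by algebra

text \<open>The same reduction for the second relation; here the constraint on the parameters stays
  as a hypothesis.\<close>

lemma telescope_b_poly:
  fixes A b p w x :: "'a::field"
  assumes "b * p * w = 1"
  shows "(b - w) * ((1 - A * x) * (1 - b * x) * (1 - w * x) * (1 - A * x^2) * (p * x)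
      - (1 - x^2) * (1 - x) * (1 - A * b * p * x^2) * (1 - A * p * w * x^2))
    = (1 - A * x^3) * ((1 - b) * (1 - w * x) * (1 - p * w * x) * (1 - A * b * p * x^2)
      - (1 - w) * (1 - b * x) * (1 - b * p * x) * (1 - A * p * w * x^2))"
  using assms by algebra
text \<open>The two factors from (p;p) and (p^2;p^2) stay on the left because exactly this product
  occurs in the certificate at \<open>Suc k\<close>. They are the only factors to be cancelled, so
  nothing is assumed about \<open>A\<close>, \<open>b\<close>, \<open>c\<close>.\<close>

lemma cubic_weight_Suc:
  assumes "p ^ Suc k \<noteq> 1" "(p ^ 2) ^ Suc k \<noteq> 1"
  shows "cubic_weight A p b c (Suc k) * (1 - (p ^ Suc k)^2) * (1 - p ^ Suc k) =
    cubic_weight A p b c k * ((1 - A * p ^ k) * (1 - b * p ^ k) * (1 - c * p ^ k) *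
      (1 - A * (p ^ k)^2) * (p * p ^ k)) /
      ((1 - A * b * p * (p ^ k)^2) * (1 - A * c * p * (p ^ k)^2))"
proof -
  have 1: "1 - p * p ^ k \<noteq> 0" "1 - p^2 * (p^2) ^ k \<noteq> 0"
    using assms by auto
  have 2: "(p ^ k)\<^sup>2 = (p^2) ^ k" "(p ^ Suc k)\<^sup>2 = p^2 * (p^2) ^ k"
    by (simp_all add: power_mult_distrib power_mult [symmetric] mult.commute)
  have 3: "p ^ (Suc k * (Suc k + 1) div 2) = p ^ (k * (k + 1) div 2) * (p * p ^ k)"
    by (simp only: triangular_Suc power_add power_Suc)
  have 4: "(n1 * a1) * (n2 * a2) * ((n3 * a3) * (n4 * a4)) /
        ((d1 * e1) * (d2 * e2) * ((d3 * e3) * (d4 * e4))) * (t * s) * e2 * e1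
     = (n1 * n2 * (n3 * n4) / (d1 * d2 * (d3 * d4)) * t) * (a2 * a3 * a4 * a1 * s) / (e3 * e4)"
    if "e1 \<noteq> 0" "e2 \<noteq> 0" for n1 a1 n2 a2 n3 a3 n4 a4 d1 e1 d2 e2 d3 e3 d4 e4 t s :: 'a
    using that by (simp add: field_simps)
  show ?thesis
    unfolding cubic_weight_def 2 3 unfolding q_pochhammer_Suc power_Suc
    by (rule 4[OF 1])
qed

lemma q_pochhammer_shift2:
  "(1 - x) * (1 - x * q) * q_pochhammer (x * q ^ 2) q k =
     q_pochhammer x q k * ((1 - x * q ^ k) * (1 - x * q * q ^ k))"
proof -
  have "(1 - x) * (1 - x * q) * q_pochhammer (x * q ^ 2) q k =
    (1 - x) * ((1 - x * q) * q_pochhammer (x * q * q) q k)"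
    by (simp add: power2_eq_square mult_ac)
  also have "\<dots> = ((1 - x) * q_pochhammer (x * q) q k) * (1 - x * q * q ^ k)"
    unfolding q_pochhammer_shift[of "x * q"] by (simp only: mult_ac)
  finally show ?thesis unfolding q_pochhammer_shift by (simp only: mult_ac)
qed

text \<open>The shift changes (c;p)_k by two factors and (Acp;p^2)_k by one. Keeping the
  k-independent prefactor on the left avoids every division by a factor that might vanish.\<close>

lemma cubic_weight_shift_c:
  "(1 - c) * (1 - c * p) / (1 - A * c * p) * cubic_weight A p b (c * p ^ 2) k =
    cubic_weight A p b c k * ((1 - c * p ^ k) * (1 - c * p * p ^ k)) / (1 - A * c * p * (p ^ k)^2)"
proof -
  have 2: "(p ^ k)\<^sup>2 = (p^2) ^ k"
    by (simp_all add: power_mult [symmetric] mult.commute)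
  have 3: "(1 - c) * (1 - c * p) * q_pochhammer (c * p ^ 2) p k =
     q_pochhammer c p k * ((1 - c * p ^ k) * (1 - c * p * p ^ k))"
    by (rule q_pochhammer_shift2)
  have 4: "(1 - A * c * p) * q_pochhammer (A * (c * p^2) * p) (p^2) k =
      q_pochhammer (A * c * p) (p^2) k * (1 - A * c * p * (p ^ k)^2)"
    using q_pochhammer_shift[of "A * c * p" "p^2" k] unfolding 2 by (simp add: mult_ac)
  have 5: "u / v * (n1 * n2 * (n3 * x) / (d1 * d2 * (d3 * y)) * t) =
      (n1 * n2 * (n3 * x') / (d1 * d2 * (d3 * y')) * t) * u' / v'"
    if "u * x = x' * u'" "v * y = y' * v'" for u v n1 n2 n3 x d1 d2 d3 y t x' y' u' v' :: 'a
  proof -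
    have "u / v * (n1 * n2 * (n3 * x) / (d1 * d2 * (d3 * y)) * t) =
       (u * x) * (n1 * n2 * n3 * t) / ((v * y) * (d1 * d2 * d3))"
      by (simp add: mult_ac)
    thus ?thesis unfolding that by (simp add: mult_ac)
  qed
  show ?thesis unfolding cubic_weight_def by (rule 5[OF 3 4])
qed

text \<open>The parameter \<open>A\<close> occurs in base \<open>p\<close> and in base
  \<open>p ^ 2\<close>. The first product contributes (1 - A)(1 - Ap) and the second another 1 - A,
  hence the square.\<close>

lemma cubic_weight_shift_A:
  "(1 - A)^2 * (1 - A * p) / ((1 - A * b * p) * (1 - A * c * p)) *
      cubic_weight (A * p ^ 2) p b c k =
    cubic_weight A p b c k * ((1 - A * p ^ k) * (1 - A * p * p ^ k) * (1 - A * (p ^ k)^2)) /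
      ((1 - A * b * p * (p ^ k)^2) * (1 - A * c * p * (p ^ k)^2))"
proof -
  have 2: "(p ^ k)\<^sup>2 = (p^2) ^ k"
    by (simp_all add: power_mult [symmetric] mult.commute)
  have 3: "(1 - A) * (1 - A * p) * q_pochhammer (A * p ^ 2) p k =
     q_pochhammer A p k * ((1 - A * p ^ k) * (1 - A * p * p ^ k))"
    by (rule q_pochhammer_shift2)
  have 4: "(1 - A * c * p) * q_pochhammer (A * p^2 * c * p) (p^2) k =
      q_pochhammer (A * c * p) (p^2) k * (1 - A * c * p * (p ^ k)^2)" for c
    using q_pochhammer_shift[of "A * c * p" "p^2" k] unfolding 2 by (simp add: mult_ac)
  have 6: "(1 - A) * q_pochhammer (A * p^2) (p^2) k = q_pochhammer A (p^2) k * (1 - A * (p ^ k)^2)"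
    unfolding 2 by (rule q_pochhammer_shift)
  have 5: "f^2 * u / (v * w) * ((z * x) * n / (d * (y1 * y2)) * t) =
      (z' * x' * n / (d * (y1' * y2')) * t) * (u1 * u2 * u3) / (v' * w')"
    if "f * u * x = x' * (u1 * u2)" "v * y1 = y1' * v'" "w * y2 = y2' * w'" "f * z = z' * u3"
    for f u v n x d y1 y2 z z' t x' y1' y2' u1 u2 u3 v' w w' :: 'a
  proof -
    have "f^2 * u / (v * w) * ((z * x) * n / (d * (y1 * y2)) * t) =
       (f * u * x) * (f * z) * (n * t) / ((v * y1) * (w * y2) * d)" by (simp add: power2_eq_square mult_ac)
    thus ?thesis unfolding that by (simp add: mult_ac)
  qed
  show ?thesis unfolding cubic_weight_def by (rule 5[OF 3 4 4 6])
qed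

text \<open>
  The certificate comes from the q-Gosper ansatz \<open>g k = s * W k * (1 - x^2) * (1 - x)\<close>, \<open>x = p^k\<close>;
  comparing coefficients of powers of \<open>x\<close> leaves the single solution \<open>s = A\<close>.
\<close>

lemma telescope_A_step:
  assumes "p = b * c" "p ^ Suc k \<noteq> 1" "(p ^ 2) ^ Suc k \<noteq> 1"
    and "A * b * p * (p ^ k)^2 \<noteq> 1" "A * c * p * (p ^ k)^2 \<noteq> 1"
  defines "g \<equiv> \<lambda>k. A * (cubic_weight A p b c k * (1 - (p ^ k)^2) * (1 - p ^ k))"
  shows "(1 - A) * cubic_term A p b c k -
    (1 - A)^2 * (1 - A * p) / ((1 - A * b * p) * (1 - A * c * p)) * cubic_term (A * p ^ 2) p b c k
    = g (Suc k) - g k"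
proof -
  define x where "x = p ^ k"
  define W where "W = cubic_weight A p b c k"
  define e where "e = 1 - A * b * p * x^2"
  define f where "f = 1 - A * c * p * x^2"
  have nz: "e \<noteq> 0" "f \<noteq> 0" using assms by (auto simp: e_def f_def x_def)
  have p3: "p ^ (3 * k) = x ^ 3" unfolding x_def by (simp add: power_mult [symmetric] mult.commute)
  have g1: "g (Suc k) = A * (W * ((1 - A * x) * (1 - b * x) * (1 - c * x) *
      (1 - A * x^2) * (p * x)) / (e * f))"
    unfolding g_def cubic_weight_Suc[OF assms(2,3)] by (simp only: W_def x_def e_def f_def)
  have g0: "g k = A * (W * (1 - x^2) * (1 - x))"
    by (simp add: g_def W_def x_def)
  have t0: "cubic_term A p b c k = (1 - A * x^3) * W"
    by (simp add: cubic_term_def p3 W_def)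
  have t1: "(1 - A)^2 * (1 - A * p) / ((1 - A * b * p) * (1 - A * c * p)) * cubic_term (A * p ^ 2) p b c k
     = (1 - A * p^2 * x^3) * (W * ((1 - A * x) * (1 - A * p * x) * (1 - A * x^2)) / (e * f))"
    unfolding cubic_term_def p3 W_def x_def e_def f_def cubic_weight_shift_A[symmetric]
    by (simp only: mult_ac)
  have poly: "A * ((1 - A * x) * (1 - b * x) * (1 - c * x) * (1 - A * x^2) * (p * x)
      - (1 - x^2) * (1 - x) * e * f)
    = (1 - A) * (1 - A * x^3) * e * f
      - (1 - A * p^2 * x^3) * (1 - A * x) * (1 - A * p * x) * (1 - A * x^2)"
    unfolding e_def f_def \<open>p = b * c\<close> by (rule telescope_A_poly)
  have "(g (Suc k) - g k) * (e * f) = W * (A * ((1 - A * x) * (1 - b * x) * (1 - c * x) * (1 - A * x^2) * (p * x)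
      - (1 - x^2) * (1 - x) * e * f))"
    using nz unfolding g1 g0 by (simp add: field_simps)
  also have "\<dots> = ((1 - A) * ((1 - A * x^3) * W) - (1 - A * p^2 * x^3) * (W * ((1 - A * x) * (1 - A * p * x) * (1 - A * x^2)) / (e * f))) * (e * f)"
    unfolding poly using nz by (simp add: field_simps)
  finally show ?thesis unfolding t0 t1 using nz by simp
qed

text \<open>
  Here \<open>b p w = 1\<close>, so the weight with parameters \<open>b\<close>, \<open>w\<close> in \<open>g\<close> is only a common factor of the two
  admissible terms, whose parameter pairs \<open>(b, w p^2)\<close> and \<open>(b p^2, w)\<close> have product \<open>p\<close>.
\<close>

lemma telescope_b_step:
  assumes "b * p * w = 1" "p ^ Suc k \<noteq> 1" "(p ^ 2) ^ Suc k \<noteq> 1"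
    and "A * b * p * (p ^ k)^2 \<noteq> 1" "A * w * p * (p ^ k)^2 \<noteq> 1"
  defines "g \<equiv> \<lambda>k. (b - w) * (cubic_weight A p b w k * (1 - (p ^ k)^2) * (1 - p ^ k))"
  shows "(1 - b) * ((1 - w) * (1 - w * p) / (1 - A * w * p) * cubic_term A p b (w * p ^ 2) k) -
    (1 - w) * ((1 - b) * (1 - b * p) / (1 - A * b * p) * cubic_term A p (b * p ^ 2) w k)
    = g (Suc k) - g k"
proof -
  define x where "x = p ^ k"
  define W where "W = cubic_weight A p b w k"
  define e where "e = 1 - A * b * p * x^2"
  define f where "f = 1 - A * w * p * x^2"
  have nz: "e \<noteq> 0" "f \<noteq> 0" using assms by (auto simp: e_def f_def x_def)
  have p3: "p ^ (3 * k) = x ^ 3" unfolding x_def by (simp add: power_mult [symmetric] mult.commute)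
  have g1: "g (Suc k) = (b - w) * (W * ((1 - A * x) * (1 - b * x) * (1 - w * x) *
      (1 - A * x^2) * (p * x)) / (e * f))"
    unfolding g_def cubic_weight_Suc[OF assms(2,3)] by (simp only: W_def x_def e_def f_def)
  have g0: "g k = (b - w) * (W * (1 - x^2) * (1 - x))"
    by (simp add: g_def W_def x_def)
  have t0: "(1 - w) * (1 - w * p) / (1 - A * w * p) * cubic_term A p b (w * p ^ 2) k
     = (1 - A * x^3) * (W * ((1 - w * x) * (1 - w * p * x)) / f)"
    unfolding cubic_term_def p3 W_def x_def e_def f_def
      cubic_weight_shift_c[symmetric]
    by (simp only: mult_ac)
  have t1: "(1 - b) * (1 - b * p) / (1 - A * b * p) * cubic_term A p (b * p ^ 2) w k
     = (1 - A * x^3) * (W * ((1 - b * x) * (1 - b * p * x)) / e)"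
    unfolding cubic_term_def p3 W_def x_def e_def f_def cubic_weight_commute[of _ _ _ w]
      cubic_weight_shift_c[symmetric]
    by (simp only: mult_ac)
  have poly: "(b - w) * ((1 - A * x) * (1 - b * x) * (1 - w * x) * (1 - A * x^2) * (p * x)
      - (1 - x^2) * (1 - x) * e * f)
    = (1 - A * x^3) * ((1 - b) * (1 - w * x) * (1 - w * p * x) * e
      - (1 - w) * (1 - b * x) * (1 - b * p * x) * f)"
    using telescope_b_poly[OF assms(1), of A x] unfolding e_def f_def by (simp only: mult_ac)
  have "(g (Suc k) - g k) * (e * f) = W * ((b - w) * ((1 - A * x) * (1 - b * x) * (1 - w * x) * (1 - A * x^2) * (p * x)
      - (1 - x^2) * (1 - x) * e * f))"
    using nz unfolding g1 g0 by (simp add: field_simps)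
  also have "\<dots> = ((1 - b) * ((1 - A * x^3) * (W * ((1 - w * x) * (1 - w * p * x)) / f)) - (1 - w) * ((1 - A * x^3) * (W * ((1 - b * x) * (1 - b * p * x)) / e))) * (e * f)"
    unfolding poly using nz by (simp add: field_simps)
  finally show ?thesis unfolding t0 t1 using nz by simp
qed

section \<open>Evaluation of the terminating sums by recursions in steps of two\<close>

lemma cubic_weight_eq_0:
  assumes "A * p ^ i = 1 \<or> b * p ^ i = 1" "i < k"
  shows "cubic_weight A p b c k = 0"
proof -
  have "q_pochhammer A p k = 0 \<or> q_pochhammer b p k = 0"
    using assms by (auto simp: q_pochhammer_eq_0_iff)
  thus ?thesis by (auto simp: cubic_weight_def)
qed

text \<open>Replacing A = p^(-N) by A p^2 = p^(-(N-2)) lowers N by two. The certificate vanishes at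
  both ends, so the sum for N, times 1 - A, is a multiple of the sum for N - 2. The last hypothesis
  keeps the denominators nonzero.\<close>

lemma sum_cubic_term_A:
  fixes p b c :: "'a::field"
  assumes "p = b * c" "p \<noteq> 0" "\<And>i. i \<in> {1..Suc N} \<Longrightarrow> p ^ (2 * i) \<noteq> 1"
    and "\<And>i j. b * p ^ i \<noteq> p ^ j"
  shows "(\<Sum>k<Suc N. cubic_term (inverse (p ^ N)) p b c k) = 0"
  using assms(3)
proof (induction N rule: less_induct)
  case (less N)
  \<comment> \<open>By p = bc, a relation c p^i = p^j would give b p^j = p^(i+1).\<close>
  have c: "c * p ^ i \<noteq> p ^ j" for i j
  proof
    assume "c * p ^ i = p ^ j"
    hence "b * p ^ j = b * c * p ^ i" by (simp add: mult_ac)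
    also have "\<dots> = p ^ Suc i" using assms(1) by simp
    finally show False using assms(4) by blast
  qed
  have pk: "p ^ i \<noteq> 1" "(p ^ 2) ^ i \<noteq> 1" if "i \<in> {1..Suc N}" for i
    using less.prems[OF that] by (auto simp: power_mult power2_eq_square power_mult_distrib mult_2 power_add)
  consider "N = 0" | "N = 1" | M where "N = Suc (Suc M)"
    by (metis One_nat_def not0_implies_Suc)
  then show ?case
  proof cases
    case 1
    \<comment> \<open>For N = 0 the only term contains the factor 1 - A = 0.\<close>
    thus ?thesis by (simp add: cubic_term_def)
  next
    case 2
    have "b \<noteq> 1" "c \<noteq> 1" using assms(4)[of 0 0] c[of 0 0] by auto
    moreover have "p \<noteq> 1" "p^2 \<noteq> 1" using pk[of 1] 2 by auto
    ultimately show ?thesis using 2 assms(2)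
      by (simp add: cubic_term_def cubic_weight_def q_pochhammer_Suc divide_simps mult_ac)
         (auto simp: algebra_simps power2_eq_square power3_eq_cube)
  next
    case (3 M)
    define A where "A = inverse (p ^ N)"
    have A2: "A * p ^ 2 = inverse (p ^ M)"
      using assms(2) unfolding A_def 3 by (simp add: field_simps power2_eq_square)
    have Ab: "A * b * p * (p ^ k)^2 \<noteq> 1" for k
    proof
      assume "A * b * p * (p ^ k)^2 = 1"
      hence "b * p ^ Suc (2 * k) = p ^ N"
        using assms(2) unfolding A_def by (simp add: field_simps power_mult)
      thus False using assms(4) by blast
    qed
    have Ac: "A * c * p * (p ^ k)^2 \<noteq> 1" for k
    proof
      assume "A * c * p * (p ^ k)^2 = 1"
      hence "c * p ^ Suc (2 * k) = p ^ N"
        using assms(2) unfolding A_def by (simp add: field_simps power_mult)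
      thus False using c by blast
    qed
    define K where "K = (1 - A)^2 * (1 - A * p) / ((1 - A * b * p) * (1 - A * c * p))"
    define g where "g = (\<lambda>k. A * (cubic_weight A p b c k * (1 - (p ^ k)^2) * (1 - p ^ k)))"
    have "(\<Sum>k<Suc N. (1 - A) * cubic_term A p b c k - K * cubic_term (A * p ^ 2) p b c k)
        = (\<Sum>k<Suc N. g (Suc k) - g k)"
      unfolding K_def g_def
      by (intro sum.cong refl telescope_A_step assms(1) Ab Ac pk) auto
    also have "\<dots> = g (Suc N) - g 0" by (rule sum_lessThan_telescope)
    also have "g 0 = 0" by (simp add: g_def)
    \<comment> \<open>The upper boundary term vanishes because (A;p)_(N+1) contains 1 - A p^N =
      0.\<close>
    also have "cubic_weight A p b c (Suc N) = 0"
      by (rule cubic_weight_eq_0[where i = N]) (use assms(2) in \<open>auto simp: A_def\<close>)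
    hence "g (Suc N) = 0" by (simp add: g_def)
    finally have eq: "(1 - A) * (\<Sum>k<Suc N. cubic_term A p b c k) =
        K * (\<Sum>k<Suc N. cubic_term (A * p ^ 2) p b c k)"
      by (simp only: sum_subtractf sum_distrib_left diff_0_right right_minus_eq)
    \<comment> \<open>The shifted sum terminates already at k = M, which brings it to the range of
      the induction hypothesis.\<close>
    have "(\<Sum>k<Suc N. cubic_term (A * p ^ 2) p b c k) = (\<Sum>k<Suc M. cubic_term (A * p ^ 2) p b c k)"
    proof (rule sum.mono_neutral_right)
      show "\<forall>i\<in>{..<Suc N} - {..<Suc M}. cubic_term (A * p ^ 2) p b c i = 0"
      proof
        fix i assume "i \<in> {..<Suc N} - {..<Suc M}"
        hence "cubic_weight (A * p ^ 2) p b c i = 0"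
          by (intro cubic_weight_eq_0[where i = M]) (use assms(2) in \<open>auto simp: A2\<close>)
        thus "cubic_term (A * p ^ 2) p b c i = 0" by (simp add: cubic_term_def)
      qed
    qed (use 3 in auto)
    also have "\<dots> = 0"
      unfolding A2 using 3 by (intro less.IH less.prems) auto
    finally have "(1 - A) * (\<Sum>k<Suc N. cubic_term A p b c k) = 0" using eq by simp
    moreover have "1 - A \<noteq> 0" using pk(1)[of N] 3 assms(2) by (auto simp: A_def field_simps)
    ultimately show ?thesis by (simp add: A_def)
  qed
qed

text \<open>Summing the second telescoping relation over k < N + 3 links the evaluations for N + 2
  and N, since the certificate vanishes at both ends.\<close>

lemma sum_cubic_term_b_rec:
  fixes A p :: "'a::field"
  assumes p0: "p \<noteq> 0" and p: "\<And>i. i > 0 \<Longrightarrow> p ^ i \<noteq> 1"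
    and A: "\<And>i j. A * p ^ i \<noteq> p ^ j"
  shows "(1 - p ^ (N + 2)) * (p ^ (N + 1) - A) *
      (\<Sum>k<N + 3. cubic_term A p (inverse (p ^ (N + 2))) (p ^ (N + 3)) k) =
    (p ^ (N + 1) - 1) * (1 - A * p ^ (N + 2)) *
      (\<Sum>k<N + 1. cubic_term A p (inverse (p ^ N)) (p ^ (N + 1)) k)"
proof -
  \<comment> \<open>With this choice b p w = 1, the pair (b, w p^2) is the one for N + 2, and (b
    p^2, w) is the one for N.\<close>
  define b where "b = inverse (p ^ (N + 2))"
  define w where "w = p ^ (N + 1)"
  have bp: "b * p ^ 2 = inverse (p ^ N)"
    using p0 by (simp add: b_def field_simps power2_eq_square)
  have wp: "w * p ^ 2 = p ^ (N + 3)"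
    by (simp add: w_def eval_nat_numeral mult_ac)
  have bpw: "b * p * w = 1" using p0 by (simp add: b_def w_def field_simps)
  have b1: "b \<noteq> 1" using p[of "N + 2"] by (metis b_def inverse_1 inverse_inverse_eq zero_less_numeral trans_less_add2)
  have w1: "w \<noteq> 1" using p[of "N + 1"] by (auto simp: w_def)
  have Ab: "A * b * p * (p ^ k)^2 \<noteq> 1" for k
  proof
    assume "A * b * p * (p ^ k)^2 = 1"
    hence "A * p ^ Suc (2 * k) = p ^ (N + 2)"
      using p0 unfolding b_def by (simp add: field_simps power_mult)
    thus False using A by blast
  qed
  have Aw: "A * w * p * (p ^ k)^2 \<noteq> 1" for k
  proof
    assume "A * w * p * (p ^ k)^2 = 1"
    hence "A * p ^ (N + 2 + 2 * k) = p ^ 0"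
      unfolding w_def by (simp add: power_add power_mult mult_ac power2_eq_square power_mult_distrib mult_2)
    thus False using A by blast
  qed
  have Ab1: "A * b * p \<noteq> 1" and Aw1: "A * w * p \<noteq> 1" using Ab[of 0] Aw[of 0] by auto
  define g where "g = (\<lambda>k. (b - w) * (cubic_weight A p b w k * (1 - (p ^ k)^2) * (1 - p ^ k)))"
  have "(\<Sum>k<N + 3. (1 - b) * ((1 - w) * (1 - w * p) / (1 - A * w * p) * cubic_term A p b (w * p ^ 2) k) -
    (1 - w) * ((1 - b) * (1 - b * p) / (1 - A * b * p) * cubic_term A p (b * p ^ 2) w k))
        = (\<Sum>k<N + 3. g (Suc k) - g k)"
    unfolding g_def using p
    by (intro sum.cong refl telescope_b_step bpw Ab Aw) (auto simp flip: power_mult simp del: power_Suc)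
  also have "\<dots> = g (N + 3) - g 0" by (rule sum_lessThan_telescope)
  also have "g 0 = 0" by (simp add: g_def)
  also have "cubic_weight A p b w (N + 3) = 0"
    by (rule cubic_weight_eq_0[where i = "N + 2"]) (use p0 in \<open>auto simp: b_def field_simps\<close>)
  hence "g (N + 3) = 0" by (simp add: g_def)
  finally have fin: "(1 - b) * ((1 - w) * (1 - w * p) / (1 - A * w * p) *
       (\<Sum>k<N + 3. cubic_term A p b (w * p ^ 2) k)) =
     (1 - w) * ((1 - b) * (1 - b * p) / (1 - A * b * p) *
       (\<Sum>k<N + 3. cubic_term A p (b * p ^ 2) w k))"
    by (simp only: sum_subtractf sum_distrib_left diff_0_right right_minus_eq)
  have "((1 - b) * (1 - w)) * ((1 - w * p) / (1 - A * w * p) * (\<Sum>k<N + 3. cubic_term A p b (w * p ^ 2) k)) =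
      ((1 - b) * (1 - w)) * ((1 - b * p) / (1 - A * b * p) * (\<Sum>k<N + 3. cubic_term A p (b * p ^ 2) w k))"
    using fin by (simp add: mult_ac)
  hence "(1 - w * p) / (1 - A * w * p) * (\<Sum>k<N + 3. cubic_term A p b (w * p ^ 2) k) =
      (1 - b * p) / (1 - A * b * p) * (\<Sum>k<N + 3. cubic_term A p (b * p ^ 2) w k)"
    using b1 w1 by (simp only: mult_cancel_left mult_eq_0_iff) simp
  hence eq: "(1 - w * p) * (1 - A * b * p) * (\<Sum>k<N + 3. cubic_term A p b (w * p ^ 2) k) =
      (1 - b * p) * (1 - A * w * p) * (\<Sum>k<N + 3. cubic_term A p (b * p ^ 2) w k)"
    using Ab1 Aw1 by (simp add: field_simps)
  have red: "(\<Sum>k<N + 3. cubic_term A p (b * p ^ 2) w k) = (\<Sum>k<N + 1. cubic_term A p (b * p ^ 2) w k)"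
  proof (rule sum.mono_neutral_right)
    show "\<forall>i\<in>{..<N + 3} - {..<N + 1}. cubic_term A p (b * p ^ 2) w i = 0"
    proof
      fix i assume "i \<in> {..<N + 3} - {..<N + 1}"
      hence "cubic_weight A p (b * p ^ 2) w i = 0"
        by (intro cubic_weight_eq_0[where i = N]) (use p0 in \<open>auto simp: bp\<close>)
      thus "cubic_term A p (b * p ^ 2) w i = 0" by (simp add: cubic_term_def)
    qed
  qed auto
  \<comment> \<open>Multiplication by w = 1/(bp) turns the remaining factors with negative powers of
    \<open>p\<close> into the polynomial factors of the claim.\<close>
  have 1: "w * (1 - b * p) = w - 1" "w * (1 - A * b * p) = w - A"
    using bpw by algebra+
  have 2: "w * p = p ^ (N + 2)" by (simp add: w_def mult_ac)
  have "(1 - w * p) * (w * (1 - A * b * p)) * (\<Sum>k<N + 3. cubic_term A p b (w * p ^ 2) k) =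
      w * ((1 - w * p) * (1 - A * b * p) * (\<Sum>k<N + 3. cubic_term A p b (w * p ^ 2) k))"
    by (simp only: mult_ac)
  also have "\<dots> = (w * (1 - b * p)) * (1 - A * (w * p)) * (\<Sum>k<N + 1. cubic_term A p (b * p ^ 2) w k)"
    unfolding eq red by (simp only: mult_ac)
  finally show ?thesis unfolding 1 2 bp wp unfolding w_def b_def .
qed

lemma power_inj:
  fixes q :: "'a::field"
  assumes "q \<noteq> 0" "\<And>i. i > 0 \<Longrightarrow> q ^ i \<noteq> 1" "q ^ i = q ^ j"
  shows "i = j"
proof -
  have *: "\<not> i < j" if "q ^ i = q ^ j" for i j :: nat
  proof
    assume "i < j"
    hence "q ^ j = q ^ i * q ^ (j - i)" by (simp flip: power_add)
    thus False using that assms(1) assms(2)[of "j - i"] \<open>i < j\<close> by simp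
  qed
  show ?thesis using *[of i j] *[of j i] assms(3) by simp
qed

text \<open>The recursion preserves the parity of N. It starts from F(0) = 1 - q and F(1) = 0; for
  even N its factors accumulate to the stated product, and for odd N the zero propagates.\<close>

lemma sum_cubic_term_b:
  fixes q :: "'a::field"
  assumes q0: "q \<noteq> 0" and q: "\<And>i. i > 0 \<Longrightarrow> q ^ i \<noteq> 1"
  defines "F \<equiv> \<lambda>N. \<Sum>k<N + 1. cubic_term q (q ^ 2) (inverse ((q ^ 2) ^ N)) ((q ^ 2) ^ (N + 1)) k"
  shows "F (2 * j) = q_pochhammer (q ^ 2) (q ^ 4) j / q_pochhammer (q ^ 4) (q ^ 4) j *
            (1 - q ^ (4 * j + 1)) * inverse (q ^ j)" (is "_ = ?R j")
    and "F (2 * j + 1) = 0"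
proof -
  define p where "p = q ^ 2"
  have p0: "p \<noteq> 0" using q0 by (simp add: p_def)
  have p: "p ^ i \<noteq> 1" if "i > 0" for i using q[of "2 * i"] that by (simp add: p_def power_mult)
  \<comment> \<open>The two sides are powers of \<open>q\<close> with exponents of different
    parity.\<close>
  have A: "q * p ^ i \<noteq> p ^ j" for i j
  proof
    assume "q * p ^ i = p ^ j"
    hence "q ^ Suc (2 * i) = q ^ (2 * j)" by (simp add: p_def power_mult)
    from power_inj[OF q0 q this] show False by presburger
  qed
  have rec: "(1 - p ^ (N + 2)) * (p ^ (N + 1) - q) * F (N + 2) =
    (p ^ (N + 1) - 1) * (1 - q * p ^ (N + 2)) * F N" for N
    using sum_cubic_term_b_rec[OF p0 p A, of N]
    by (simp add: F_def p_def eval_nat_numeral)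
  have nz: "(1 - p ^ (N + 2)) * (p ^ (N + 1) - q) \<noteq> 0" for N
    using p[of "N + 2"] A[of 0 "N + 1"] by (auto simp: right_minus_eq)
  show "F (2 * j) = ?R j"
  proof (induction j)
    case 0
    show ?case by (simp add: F_def cubic_term_def cubic_weight_def)
  next
    case (Suc j)
    have nz1: "q_pochhammer (q ^ 4) (q ^ 4) i \<noteq> 0" for i
    proof (rule q_pochhammer_nonzero)
      fix k show "q ^ 4 * (q ^ 4) ^ k \<noteq> 1"
        using q[of "4 + 4 * k"] by (simp add: power_add power_mult)
    qed
    have nz2: "1 - q ^ 4 * (q ^ 4) ^ j \<noteq> 0"
      using q[of "4 + 4 * j"] by (simp add: power_add power_mult)
    have pp: "p ^ i = q ^ (2 * i)" for i by (simp add: p_def power_mult)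
    have q4: "q ^ 4 * (q ^ 4) ^ j = q ^ (4 + 4 * j)" "q ^ 2 * (q ^ 4) ^ j = q ^ (2 + 4 * j)"
      by (simp_all only: power_add power_mult)
    have "2 * (2 * j + 2) = 4 + 4 * j" by simp
    hence e1: "1 - p ^ (2 * j + 2) = 1 - q ^ 4 * (q ^ 4) ^ j" by (simp only: pp q4)
    have "2 * (2 * j + 1) = Suc (4 * j + 1)" by simp
    hence e2: "p ^ (2 * j + 1) - q = q * (q ^ (4 * j + 1) - 1)"
      by (simp only: pp power_Suc right_diff_distrib mult_1_right)
    have "2 * (2 * j + 1) = 2 + 4 * j" by simp
    hence e3: "p ^ (2 * j + 1) - 1 = q ^ 2 * (q ^ 4) ^ j - 1" by (simp only: pp q4)
    have "4 * Suc j + 1 = Suc (2 * (2 * j + 2))" by simp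
    hence e4: "1 - q * p ^ (2 * j + 2) = 1 - q ^ (4 * Suc j + 1)" by (simp only: pp power_Suc)
    have "(1 - p ^ (2 * j + 2)) * (p ^ (2 * j + 1) - q) * F (2 * j + 2) =
        (p ^ (2 * j + 1) - 1) * (1 - q * p ^ (2 * j + 2)) * ?R j"
      unfolding rec Suc ..
    also have "\<dots> = (1 - p ^ (2 * j + 2)) * (p ^ (2 * j + 1) - q) * ?R (Suc j)"
      unfolding e1 e2 e3 e4 q_pochhammer_Suc using nz1[of j] nz2 q0
      by (simp add: field_simps)
    finally have "F (2 * j + 2) = ?R (Suc j)" by (simp only: mult_left_cancel[OF nz])
    thus ?case by simp
  qed
  show "F (2 * j + 1) = 0"
  proof (induction j)
    case 0
    \<comment> \<open>F(1) has two terms, which cancel; these inequalities clear their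
      denominators.\<close>
    have "q \<noteq> 1" "p \<noteq> 1" "p^2 \<noteq> 1" "q * p ^ 3 \<noteq> 1" using q[of 1] p[of 1] p[of 2] A[of 3 0] by auto
    thus ?case using p0
      by (simp add: F_def flip: p_def)
        (simp add: cubic_term_def cubic_weight_def q_pochhammer_Suc divide_simps eval_nat_numeral mult_ac,
         simp add: algebra_simps)
  next
    case (Suc j)
    have "(1 - p ^ (2 * j + 1 + 2)) * (p ^ (2 * j + 1 + 1) - q) * F (2 * j + 1 + 2) = 0"
      unfolding rec Suc by simp
    hence "F (2 * j + 1 + 2) = 0" using nz[of "2 * j + 1"] by simp
    thus ?case by simp
  qed
qed

section \<open>Simultaneous evaluation of fractions\<close>

definition unital_hom :: "('a::comm_ring_1 \<Rightarrow> 'b::comm_ring_1) \<Rightarrow> bool" where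
  "unital_hom h \<longleftrightarrow> h 1 = 1 \<and> (\<forall>x y. h (x + y) = h x + h y) \<and> (\<forall>x y. h (x * y) = h x * h y)"

context
  fixes h :: "'a::comm_ring_1 \<Rightarrow> 'b::comm_ring_1"
  assumes h: "unital_hom h"
begin

lemma unital_hom_1: "h 1 = 1" and unital_hom_add: "h (x + y) = h x + h y"
  and unital_hom_mult: "h (x * y) = h x * h y"
  using h by (auto simp: unital_hom_def)

lemma unital_hom_0: "h 0 = 0"
  using unital_hom_add[of 0 0] by simp

lemma unital_hom_diff: "h (x - y) = h x - h y"
  using unital_hom_add[of "x - y" y] by simp

lemma unital_hom_power: "h (x ^ k) = h x ^ k"
  by (induction k) (simp_all add: unital_hom_1 unital_hom_mult)

lemma unital_hom_sum: "h (sum f A) = (\<Sum>x\<in>A. h (f x))"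
  by (induction A rule: infinite_finite_induct) (simp_all add: unital_hom_0 unital_hom_add)

lemma unital_hom_map_poly: "unital_hom (map_poly h)"
  unfolding unital_hom_def
  by (auto intro!: poly_eqI simp: coeff_map_poly coeff_mult unital_hom_0 unital_hom_1
      unital_hom_add unital_hom_mult unital_hom_sum)

lemma unital_hom_poly: "unital_hom (\<lambda>p. poly (map_poly h p) x)"
  using unital_hom_map_poly by (simp add: unital_hom_def)

lemma unital_hom_poly_const: "poly (map_poly h p) (h c) = h (poly p c)"
  by (induction p) (simp_all add: map_poly_pCons unital_hom_0 unital_hom_add unital_hom_mult)

end

lemma unital_hom_of_rat: "unital_hom (of_rat :: rat \<Rightarrow> complex)"
  by (simp add: unital_hom_def of_rat_add of_rat_mult)

lemma unital_hom_to_fract: "unital_hom to_fract"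
  by (simp add: unital_hom_def)

lemma unital_hom_const: "unital_hom (\<lambda>c. [:c:])"
  by (simp add: unital_hom_def one_pCons)

lemma unital_hom_comp: "unital_hom f \<Longrightarrow> unital_hom g \<Longrightarrow> unital_hom (\<lambda>x. f (g x))"
  by (simp add: unital_hom_def)

text \<open>A single representation N/D has to serve all homomorphisms in \<open>H\<close> at once.
  This yields one denominator that none of them kills, as needed for coprimality to the whole
  modulus.\<close>

definition has_values :: "('r::idom \<Rightarrow> 'k::field) set \<Rightarrow> 'r fract \<Rightarrow> (('r \<Rightarrow> 'k) \<Rightarrow> 'k) \<Rightarrow> bool" where
  "has_values H f v \<longleftrightarrow>
     (\<exists>N D. D \<noteq> 0 \<and> f = Fract N D \<and> (\<forall>h\<in>H. h D \<noteq> 0 \<and> v h = h N / h D))"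

locale evaluations =
  fixes H :: "('r::idom \<Rightarrow> 'k::field) set"
  assumes nonempty: "H \<noteq> {}" and hom: "h \<in> H \<Longrightarrow> unital_hom h"
begin

lemmas hom_simps = hom[THEN unital_hom_1] hom[THEN unital_hom_0] hom[THEN unital_hom_add]
  hom[THEN unital_hom_mult] hom[THEN unital_hom_diff]

lemma has_values_to_fract: "has_values H (to_fract x) (\<lambda>h. h x)"
  unfolding has_values_def by (rule exI[of _ x], rule exI[of _ 1]) (auto simp: to_fract_def hom_simps)

lemma has_values_1: "has_values H 1 (\<lambda>_. 1)"
  unfolding has_values_def by (rule exI[of _ 1], rule exI[of _ 1]) (auto simp: hom_simps One_fract_def)

lemma has_values_0: "has_values H 0 (\<lambda>_. 0)"
  unfolding has_values_def by (rule exI[of _ 0], rule exI[of _ 1]) (auto simp: hom_simps Zero_fract_def)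

lemma has_values_add:
  assumes "has_values H f v" "has_values H g w"
  shows "has_values H (f + g) (\<lambda>h. v h + w h)"
proof -
  obtain N D where 1: "D \<noteq> 0" "f = Fract N D" "\<And>h. h \<in> H \<Longrightarrow> h D \<noteq> 0 \<and> v h = h N / h D"
    using assms(1) unfolding has_values_def by blast
  obtain M E where 2: "E \<noteq> 0" "g = Fract M E" "\<And>h. h \<in> H \<Longrightarrow> h E \<noteq> 0 \<and> w h = h M / h E"
    using assms(2) unfolding has_values_def by blast
  show ?thesis unfolding has_values_def
    by (rule exI[of _ "N * E + M * D"], rule exI[of _ "D * E"])
       (use 1 2 in \<open>auto simp: hom_simps field_simps\<close>)
qed

lemma has_values_diff:
  assumes "has_values H f v" "has_values H g w"
  shows "has_values H (f - g) (\<lambda>h. v h - w h)"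
proof -
  obtain N D where 1: "D \<noteq> 0" "f = Fract N D" "\<And>h. h \<in> H \<Longrightarrow> h D \<noteq> 0 \<and> v h = h N / h D"
    using assms(1) unfolding has_values_def by blast
  obtain M E where 2: "E \<noteq> 0" "g = Fract M E" "\<And>h. h \<in> H \<Longrightarrow> h E \<noteq> 0 \<and> w h = h M / h E"
    using assms(2) unfolding has_values_def by blast
  show ?thesis unfolding has_values_def
    by (rule exI[of _ "N * E - M * D"], rule exI[of _ "D * E"])
       (use 1 2 in \<open>auto simp: hom_simps field_simps\<close>)
qed

lemma has_values_mult:
  assumes "has_values H f v" "has_values H g w"
  shows "has_values H (f * g) (\<lambda>h. v h * w h)"
proof -
  obtain N D where 1: "D \<noteq> 0" "f = Fract N D" "\<And>h. h \<in> H \<Longrightarrow> h D \<noteq> 0 \<and> v h = h N / h D"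
    using assms(1) unfolding has_values_def by blast
  obtain M E where 2: "E \<noteq> 0" "g = Fract M E" "\<And>h. h \<in> H \<Longrightarrow> h E \<noteq> 0 \<and> w h = h M / h E"
    using assms(2) unfolding has_values_def by blast
  show ?thesis unfolding has_values_def
    by (rule exI[of _ "N * M"], rule exI[of _ "D * E"])
       (use 1 2 in \<open>auto simp: hom_simps field_simps\<close>)
qed

lemma has_values_inverse:
  assumes "has_values H f v" "\<And>h. h \<in> H \<Longrightarrow> v h \<noteq> 0"
  shows "has_values H (inverse f) (\<lambda>h. inverse (v h))"
proof -
  obtain N D where 1: "D \<noteq> 0" "f = Fract N D" "\<And>h. h \<in> H \<Longrightarrow> h D \<noteq> 0 \<and> v h = h N / h D"
    using assms(1) unfolding has_values_def by blast
  have 2: "h N \<noteq> 0" if "h \<in> H" for h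
    using assms(2)[OF that] 1(3)[OF that] by auto
  \<comment> \<open>Some \<open>h\<close> in \<open>H\<close> exists, and it maps \<open>N\<close>
    to a nonzero element.\<close>
  moreover have "N \<noteq> 0" using nonempty 2 hom_simps(2) by auto
  ultimately have "N \<noteq> 0 \<and> inverse f = Fract D N \<and> (\<forall>h\<in>H. h N \<noteq> 0 \<and> inverse (v h) = h D / h N)"
    using 1 by auto
  thus ?thesis unfolding has_values_def by blast
qed

lemma has_values_divide:
  assumes "has_values H f v" "has_values H g w" "\<And>h. h \<in> H \<Longrightarrow> w h \<noteq> 0"
  shows "has_values H (f / g) (\<lambda>h. v h / w h)"
  using has_values_mult[OF assms(1) has_values_inverse[OF assms(2,3)]] by (simp add: divide_inverse)

lemma has_values_power:
  "has_values H f v \<Longrightarrow> has_values H (f ^ k) (\<lambda>h. v h ^ k)"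
  by (induction k) (simp_all add: has_values_1 has_values_mult)

lemma has_values_sum:
  "(\<And>i. i \<in> A \<Longrightarrow> has_values H (f i) (\<lambda>h. v h i)) \<Longrightarrow>
    has_values H (\<Sum>i\<in>A. f i) (\<lambda>h. \<Sum>i\<in>A. v h i)"
  by (induction A rule: infinite_finite_induct) (simp_all add: has_values_0 has_values_add)

lemma has_values_q_pochhammer:
  assumes "has_values H x v" "has_values H q w"
  shows "has_values H (q_pochhammer x q k) (\<lambda>h. q_pochhammer (v h) (w h) k)"
proof (induction k)
  case 0
  show ?case using has_values_1 by (simp add: q_pochhammer_def)
next
  case (Suc k)
  have "has_values H (1 - x * q ^ k) (\<lambda>h. 1 - v h * w h ^ k)"
    by (intro has_values_diff has_values_mult has_values_power has_values_1 assms)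
  from has_values_mult[OF Suc this] show ?case by (simp add: q_pochhammer_def)
qed

end

section \<open>Divisibility and coprimality of polynomials\<close>

lemma prod_linear_dvd:
  fixes p :: "'a::field poly"
  assumes "finite S" "\<And>z. z \<in> S \<Longrightarrow> poly p z = 0"
  shows "(\<Prod>z\<in>S. [:- z, 1:]) dvd p"
  using assms
proof (induction S rule: finite_induct)
  case (insert z S)
  then obtain r where r: "p = (\<Prod>z\<in>S. [:- z, 1:]) * r" by (auto elim: dvdE)
  have "poly (\<Prod>z\<in>S. [:- z, 1:]) z \<noteq> 0" using insert by (auto simp: poly_prod)
  hence "poly r z = 0" using insert.prems[of z] r by auto
  hence "[:- z, 1:] dvd r" by (simp add: poly_eq_0_iff_dvd)
  hence "[:- z, 1:] * (\<Prod>z\<in>S. [:- z, 1:]) dvd p" unfolding r by (subst mult.commute) (rule mult_dvd_mono[OF dvd_refl])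
  thus ?case by (simp only: prod.insert[OF insert.hyps])
qed simp

lemma cyclotomic_nonzero: "n > 0 \<Longrightarrow> cyclotomic n \<noteq> 0"
  using map_poly_cyclotomic[of n] finite_primitive_roots_unity[of n]
  by (auto simp: prod_zero_iff)

text \<open>Divisibility holds over the complex numbers by the linear factors. Division with
  remainder commutes with the embedding of the rationals, so the rational remainder is divisible by
  a polynomial of larger degree and must vanish.\<close>

lemma cyclotomic_dvd:
  assumes "n > 0" "\<And>z. z \<in> primitive_roots_unity n \<Longrightarrow> poly (map_poly of_rat c) z = 0"
  shows "cyclotomic n dvd c"
proof -
  let ?C = "cyclotomic n" and ?m = "map_poly (of_rat :: rat \<Rightarrow> complex)"
  have m: "unital_hom ?m" by (rule unital_hom_map_poly[OF unital_hom_of_rat])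
  have "?m ?C dvd ?m c"
    unfolding map_poly_cyclotomic[OF assms(1)]
    using assms finite_primitive_roots_unity by (intro prod_linear_dvd) auto
  moreover have "?m c = ?m ?C * ?m (c div ?C) + ?m (c mod ?C)"
    by (simp flip: unital_hom_mult[OF m] unital_hom_add[OF m])
  ultimately have dvd: "?m ?C dvd ?m (c mod ?C)" by (metis dvd_add_right_iff dvd_triv_left)
  show ?thesis
  proof (rule ccontr)
    assume "\<not> ?C dvd c"
    hence nz: "c mod ?C \<noteq> 0" by (simp add: mod_eq_0_iff_dvd)
    hence "degree (c mod ?C) < degree ?C"
      using degree_mod_less[OF cyclotomic_nonzero[OF assms(1)]] by blast
    moreover have "?m (c mod ?C) \<noteq> 0" using nz by (simp add: map_poly_eq_0_iff)
    from dvd_imp_degree_le[OF dvd this] have "degree ?C \<le> degree (c mod ?C)"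
      by (simp add: degree_map_poly)
    ultimately show False by simp
  qed
qed

text \<open>A unit coefficient makes the linear polynomial primitive, so its constant divisors are
  units. In a factorization one factor is constant: either the common divisor is a unit, or it is
  associated to the linear polynomial, which does not divide \<open>D\<close>.\<close>

lemma coprime_linear_poly:
  fixes D :: "'a::idom_divide poly"
  assumes "y \<noteq> 0" "x dvd 1 \<or> y dvd 1" "\<not> [:x, y:] dvd D"
  shows "coprime D [:x, y:]"
proof (rule coprimeI)
  fix c assume c: "c dvd D" "c dvd [:x, y:]"
  have const: "is_unit [:u:]" if "[:u:] dvd [:x, y:]" for u
  proof -
    have "\<forall>i. u dvd coeff [:x, y:] i" using that const_poly_dvd_iff by blast
    from this[rule_format, of 0] this[rule_format, of 1] have "u dvd x" "u dvd y" by auto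
    hence "u dvd 1" using assms(2) dvd_trans by blast
    thus ?thesis by (simp add: is_unit_const_poly_iff)
  qed
  obtain e where e: "[:x, y:] = c * e" using c(2) by (auto elim: dvdE)
  have "c \<noteq> 0" "e \<noteq> 0" using e assms(1) by auto
  hence "degree c + degree e = 1"
    using assms(1) by (metis degree_mult_eq degree_pCons_eq_if e degree_pCons_0 pCons_eq_0_iff One_nat_def)
  then consider "degree c = 0" | "degree e = 0" by linarith
  thus "is_unit c"
  proof cases
    case 1
    then obtain u where "c = [:u:]" by (auto elim: degree_eq_zeroE)
    thus ?thesis using const c(2) by blast
  next
    case 2
    then obtain u where u: "e = [:u:]" by (auto elim: degree_eq_zeroE)
    have "is_unit e" unfolding u by (rule const) (use e u in \<open>metis dvd_triv_right\<close>)
    hence "[:x, y:] dvd c" unfolding e by (simp add: mult_unit_dvd_iff)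
    hence False using c(1) assms(3) dvd_trans by blast
    thus ?thesis ..
  qed
qed

lemma smult_sum: "smult c (sum f A) = (\<Sum>x\<in>A. smult c (f x))"
  by (induction A rule: infinite_finite_induct) (simp_all add: smult_add_right)

text \<open>The hypothesis says y^d N(1/y) = 0 without inverting \<open>y\<close>. Modulo 1 - z with
  z = yX every power of z is 1, so y^d N, a combination of these powers, reduces to the sum in the
  hypothesis.\<close>

lemma linear_dvd_of_reciprocal_root:
  fixes N :: "'a::comm_ring_1 poly"
  assumes "(\<Sum>i\<le>degree N. coeff N i * y ^ (degree N - i)) = 0"
  shows "[:1, - y:] dvd N"
proof -
  define d where "d = degree N"
  define z where "z = [:0, y:]"
  have l: "[:1, - y:] = 1 - z" by (simp add: z_def one_pCons)
  have pw: "1 - z dvd 1 - z ^ i" for i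
    using one_diff_power_eq[of z i] by simp
  have "smult (y ^ d) N = (\<Sum>i\<le>d. smult (y ^ d) (monom (coeff N i) i))"
    by (subst poly_as_sum_of_monoms[of N, symmetric]) (simp add: d_def smult_sum)
  also have "\<dots> = (\<Sum>i\<le>d. [:coeff N i * y ^ (d - i):] * z ^ i)"
  proof (rule sum.cong)
    fix i assume "i \<in> {..d}"
    have "z = monom y 1" by (simp add: z_def monom_altdef)
    hence "z ^ i = monom (y ^ i) i" by (simp add: monom_power)
    moreover have "y ^ d = y ^ (d - i) * y ^ i" using \<open>i \<in> {..d}\<close> by (simp flip: power_add)
    ultimately show "smult (y ^ d) (monom (coeff N i) i) = [:coeff N i * y ^ (d - i):] * z ^ i"
      by (simp add: smult_monom mult_ac)
  qed simp
  also have "\<dots> = (\<Sum>i\<le>d. [:coeff N i * y ^ (d - i):]) - (\<Sum>i\<le>d. [:coeff N i * y ^ (d - i):] * (1 - z ^ i))"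
    by (simp only: sum_subtractf[symmetric] right_diff_distrib mult_1_right) simp
  also have "(\<Sum>i\<le>d. [:coeff N i * y ^ (d - i):]) = [:\<Sum>i\<le>d. coeff N i * y ^ (d - i):]"
    by (simp add: unital_hom_sum[OF unital_hom_const])
  also have "\<dots> = 0" using assms by (simp add: d_def)
  finally have "1 - z dvd smult (y ^ d) N"
    by (auto intro!: dvd_sum dvd_smult pw)
  \<comment> \<open>The factor X^d turns y^d into z^d, which is 1 modulo 1 - z; this removes y^d
    without cancelling it.\<close>
  hence "1 - z dvd [:0, 1:] ^ d * smult (y ^ d) N" by (rule dvd_mult)
  also have "[:0, 1:] ^ d * smult (y ^ d) N = z ^ d * N"
  proof -
    have "z = smult y [:0, 1:]" by (simp add: z_def)
    hence "z ^ d = smult (y ^ d) ([:0, 1:] ^ d)" by (simp only: smult_power)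
    thus ?thesis by (simp only: mult_smult_left mult_smult_right)
  qed
  finally have "1 - z dvd z ^ d * N + (1 - z ^ d) * N"
    using pw[of d] by (intro dvd_add) auto
  thus ?thesis unfolding l by (simp add: algebra_simps)
qed

section \<open>Evaluations that detect the modulus\<close>

definition embed :: "rat poly \<Rightarrow> complex poly fract" where
  "embed c = to_fract (map_poly of_rat c)"

text \<open>The value at \<open>z\<close> is placed among the constants of the field that is also
  the target of \<open>embed\<close>; all evaluations then share one codomain and
  \<open>t_var\<close> remains free as the image of a.\<close>

definition embed_at :: "complex \<Rightarrow> rat poly \<Rightarrow> complex poly fract" where
  "embed_at z c = to_fract [:poly (map_poly of_rat c) z:]"

definition t_var :: "complex poly fract" where
  "t_var = to_fract [:0, 1:]"

definition eval_ext :: "('a::comm_ring_1 \<Rightarrow> 'b::comm_ring_1) \<Rightarrow> 'b \<Rightarrow> 'a poly \<Rightarrow> 'b" where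
  "eval_ext h x N = poly (map_poly h N) x"

text \<open>In this order the evaluations kill a - q^n, 1 - a q^n and the cyclotomic factor.\<close>

definition evals :: "nat \<Rightarrow> (rat poly poly \<Rightarrow> complex poly fract) set" where
  "evals n = {eval_ext embed (t_var ^ n), eval_ext embed (inverse (t_var ^ n))} \<union>
     (\<lambda>z. eval_ext (embed_at z) t_var) ` primitive_roots_unity n"

lemma unital_hom_embed: "unital_hom embed"
  unfolding embed_def
  by (intro unital_hom_comp[OF unital_hom_to_fract] unital_hom_map_poly unital_hom_of_rat)

lemma unital_hom_embed_at: "unital_hom (embed_at z)"
  unfolding embed_at_def
  by (intro unital_hom_comp[OF unital_hom_to_fract] unital_hom_comp[OF unital_hom_const]
      unital_hom_poly unital_hom_of_rat)

lemma unital_hom_eval_ext: "unital_hom h \<Longrightarrow> unital_hom (eval_ext h x)"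
  using unital_hom_poly[of h x] by (simp add: eval_ext_def[abs_def])

interpretation evals: evaluations "evals n" for n
  by standard (auto simp: evals_def intro: unital_hom_eval_ext unital_hom_embed unital_hom_embed_at)

lemma eval_ext_q_var: "unital_hom h \<Longrightarrow> eval_ext h x q_var = h [:0, 1:]"
  by (simp add: eval_ext_def q_var_def map_poly_pCons unital_hom_0)

lemma eval_ext_a_var: "unital_hom h \<Longrightarrow> eval_ext h x a_var = x"
  by (simp add: eval_ext_def a_var_def map_poly_pCons unital_hom_0 unital_hom_1)

lemma embed_X: "embed [:0, 1:] = t_var"
  by (simp add: embed_def t_var_def map_poly_pCons)

lemma embed_at_X: "embed_at z [:0, 1:] = to_fract [:z:]"
  by (simp add: embed_at_def map_poly_pCons)

lemma t_var_power: "t_var ^ i = to_fract (monom 1 i)"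
  by (simp add: t_var_def unital_hom_power[OF unital_hom_to_fract, symmetric] monom_altdef)

lemma t_var_power_neq_1: "i > 0 \<Longrightarrow> t_var ^ i \<noteq> 1"
proof
  assume "i > 0" "t_var ^ i = 1"
  hence "to_fract (monom (1::complex) i) = to_fract 1" by (simp add: t_var_power)
  hence "monom (1::complex) i = 1" by (simp only: to_fract_eq_iff)
  thus False using \<open>i > 0\<close> by (metis degree_1 degree_monom_eq less_irrefl zero_neq_one)
qed

lemma t_var_nonzero: "t_var \<noteq> 0"
  by (simp add: t_var_def)

lemma q_var_power: "q_var ^ n = [:[:0, 1:] ^ n:]"
  unfolding q_var_def by (rule unital_hom_power[OF unital_hom_const, symmetric])

lemma one_minus_aq: "1 - a_var * q_var ^ n = [:1, - ([:0, 1:] ^ n):]"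
  unfolding q_var_power a_var_def by (simp add: one_pCons)

lemma a_minus_q: "a_var - q_var ^ n = [:- ([:0, 1:] ^ n), 1:]"
  unfolding q_var_power a_var_def by simp

lemma embed_eq_0_iff: "embed c = 0 \<longleftrightarrow> c = 0"
  unfolding embed_def to_fract_eq_0_iff by (subst map_poly_eq_0_iff) auto

text \<open>As a goes to t, the result is a polynomial in t, so it vanishes only if each coefficient
  of \<open>N\<close> vanishes at \<open>z\<close>.\<close>

lemma eval_ext_embed_at:
  "eval_ext (embed_at z) t_var N = to_fract (map_poly (\<lambda>c. poly (map_poly of_rat c) z) N)"
proof (induction N)
  case (pCons c N)
  have "eval_ext (embed_at z) t_var (pCons c N) = embed_at z c + t_var * eval_ext (embed_at z) t_var N"
    by (simp add: eval_ext_def map_poly_pCons unital_hom_0[OF unital_hom_embed_at])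
  also have "\<dots> = to_fract ([:poly (map_poly of_rat c) z:] + [:0, 1:] * map_poly (\<lambda>c. poly (map_poly of_rat c) z) N)"
    unfolding pCons.IH by (simp only: embed_at_def t_var_def to_fract_add to_fract_mult)
  finally show ?case by (simp add: map_poly_pCons)
qed (simp add: eval_ext_def)

text \<open>Each kind of evaluation gives divisibility by one factor: the factor theorem for a -
  q^n, a reciprocal root for 1 - a q^n, and \<open>cyclotomic_dvd\<close> on each coefficient. The
  three factors are pairwise coprime.\<close>

lemma evals_dvd:
  assumes "n > 0" and N: "\<And>h. h \<in> evals n \<Longrightarrow> h N = 0"
  shows "[:cyclotomic n:] * (1 - a_var * q_var ^ n) * (a_var - q_var ^ n) dvd N"
proof -
  define y where "y = ([:0, 1:] ^ n :: rat poly)"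
  have y0: "y \<noteq> 0" by (simp add: y_def)
  have t: "t_var ^ n = embed y"
    by (simp add: y_def unital_hom_power[OF unital_hom_embed] embed_X)
  have dy: "degree y = n" by (simp add: y_def degree_power_eq)
  have "eval_ext embed (embed y) N = 0" using N by (simp add: evals_def t)
  hence "poly N y = 0"
    by (simp add: eval_ext_def unital_hom_poly_const[OF unital_hom_embed] embed_eq_0_iff)
  hence 1: "[:- y, 1:] dvd N" by (simp add: poly_eq_0_iff_dvd)
  \<comment> \<open>The evaluation at a = q^(-n) is multiplied by q^(n deg N), which gives the
    reversed polynomial with a value in the image of \<open>embed\<close>.\<close>
  have "embed (\<Sum>i\<le>degree N. coeff N i * y ^ (degree N - i)) =
      (\<Sum>i\<le>degree N. embed (coeff N i) * embed y ^ (degree N - i))"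
    by (simp add: unital_hom_sum[OF unital_hom_embed] unital_hom_mult[OF unital_hom_embed]
        unital_hom_power[OF unital_hom_embed])
  also have "\<dots> = (\<Sum>i\<le>degree N. embed y ^ degree N * (embed (coeff N i) * inverse (embed y) ^ i))"
  proof (rule sum.cong)
    fix i assume "i \<in> {..degree N}"
    hence "embed y ^ degree N = embed y ^ (degree N - i) * embed y ^ i" by (simp flip: power_add)
    thus "embed (coeff N i) * embed y ^ (degree N - i) =
      embed y ^ degree N * (embed (coeff N i) * inverse (embed y) ^ i)"
      using y0 by (simp add: embed_eq_0_iff field_simps)
  qed simp
  also have "\<dots> = embed y ^ degree N * eval_ext embed (inverse (embed y)) N"
  proof -
    have "degree (map_poly embed N) = degree N"
      by (rule degree_map_poly) (simp_all add: embed_eq_0_iff)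
    thus ?thesis
      by (simp add: eval_ext_def poly_altdef sum_distrib_left coeff_map_poly unital_hom_0[OF unital_hom_embed])
  qed
  also have "eval_ext embed (inverse (embed y)) N = 0" using N by (simp add: evals_def t)
  finally have "(\<Sum>i\<le>degree N. coeff N i * y ^ (degree N - i)) = 0" by (simp add: embed_eq_0_iff)
  hence 2: "[:1, - y:] dvd N" by (rule linear_dvd_of_reciprocal_root)
  have 3: "[:cyclotomic n:] dvd N"
    unfolding const_poly_dvd_iff
  proof (intro allI cyclotomic_dvd[OF assms(1)])
    fix i z assume "z \<in> primitive_roots_unity n"
    hence "eval_ext (embed_at z) t_var N = 0" using N by (simp add: evals_def)
    hence "map_poly (\<lambda>c. poly (map_poly of_rat c) z) N = 0"
      by (simp only: eval_ext_embed_at to_fract_eq_0_iff)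
    hence "coeff (map_poly (\<lambda>c. poly (map_poly of_rat c) z) N) i = 0" by simp
    thus "poly (map_poly of_rat (coeff N i)) z = 0" by (simp add: coeff_map_poly)
  qed
  have nd: "\<not> [:u, v:] dvd [:cyclotomic n:]" if "v \<noteq> 0" for u v
  proof
    assume "[:u, v:] dvd [:cyclotomic n:]"
    from dvd_imp_degree_le[OF this] show False using cyclotomic_nonzero[OF assms(1)] that by simp
  qed
  have c1: "coprime [:cyclotomic n:] [:1, - y:]" "coprime [:cyclotomic n:] [:- y, 1:]"
    using y0 nd by (auto intro!: coprime_linear_poly)
  have "\<not> [:- y, 1:] dvd [:1, - y:]"
  proof
    assume "[:- y, 1:] dvd [:1, - y:]"
    \<comment> \<open>Substitute y for a.\<close>
    hence "1 = y * y" by (simp add: poly_eq_0_iff_dvd[symmetric])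
    hence "degree (y * y) = 0" by (metis degree_1)
    thus False using y0 dy assms(1) by (simp add: degree_mult_eq)
  qed
  hence c2: "coprime [:1, - y:] [:- y, 1:]" by (intro coprime_linear_poly) auto
  have "[:cyclotomic n:] * [:1, - y:] dvd N" using 3 2 c1(1) by (rule divides_mult)
  moreover note 1
  moreover have "coprime ([:cyclotomic n:] * [:1, - y:]) [:- y, 1:]"
    using c1 c2 by (simp only: coprime_mult_left_iff)
  ultimately have "[:cyclotomic n:] * [:1, - y:] * [:- y, 1:] dvd N"
    by (rule divides_mult)
  thus ?thesis unfolding one_minus_aq a_minus_q y_def .
qed

text \<open>No polynomial killed by an evaluation divides \<open>D\<close>, which settles the linear
  factors. A common divisor with the cyclotomic factor is free of a; if it were not constant, a
  complex root of it would be a primitive root of unity whose evaluation kills it.\<close>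

lemma evals_coprime:
  assumes "n > 0" and D: "\<And>h. h \<in> evals n \<Longrightarrow> h D \<noteq> 0"
  shows "coprime D ([:cyclotomic n:] * (1 - a_var * q_var ^ n) * (a_var - q_var ^ n))"
proof -
  have not_dvd: "\<not> p dvd D" if "h \<in> evals n" "h p = 0" for h p
    using D[OF that(1)] that(2) by (auto elim!: dvdE simp: evals.hom_simps(4)[OF that(1)])
  have 1: "coprime D (a_var - q_var ^ n)"
  proof -
    define h where "h = eval_ext embed (t_var ^ n)"
    have h: "h \<in> evals n" by (simp add: evals_def h_def)
    have "h (a_var - q_var ^ n) = 0"
      by (simp add: evals.hom_simps[OF h] unital_hom_power[OF evals.hom[OF h]])
         (simp add: h_def eval_ext_q_var eval_ext_a_var unital_hom_embed embed_X)
    from not_dvd[OF h this] show ?thesis unfolding a_minus_q by (intro coprime_linear_poly) auto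
  qed
  have 2: "coprime D (1 - a_var * q_var ^ n)"
  proof -
    define h where "h = eval_ext embed (inverse (t_var ^ n))"
    have h: "h \<in> evals n" by (simp add: evals_def h_def)
    have "h (1 - a_var * q_var ^ n) = 0"
      by (simp add: evals.hom_simps[OF h] unital_hom_power[OF evals.hom[OF h]])
         (simp add: h_def eval_ext_q_var eval_ext_a_var unital_hom_embed embed_X t_var_nonzero)
    from not_dvd[OF h this] show ?thesis unfolding one_minus_aq by (intro coprime_linear_poly) auto
  qed
  have 3: "coprime D [:cyclotomic n:]"
  proof (rule coprimeI)
    fix c assume c: "c dvd D" "c dvd [:cyclotomic n:]"
    have nz: "cyclotomic n \<noteq> 0" by (rule cyclotomic_nonzero[OF assms(1)])
    have "degree c = 0" using dvd_imp_degree_le[OF c(2)] nz by simp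
    then obtain u where u: "c = [:u:]" by (auto elim: degree_eq_zeroE)
    have ud: "u dvd cyclotomic n"
      using c(2) unfolding u const_poly_dvd_iff by (metis coeff_pCons_0)
    have "u \<noteq> 0" using ud nz by auto
    have "degree u = 0"
    proof (rule ccontr)
      assume "degree u \<noteq> 0"
      let ?m = "map_poly (of_rat :: rat \<Rightarrow> complex)"
      have "degree (?m u) \<noteq> 0" using \<open>degree u \<noteq> 0\<close> by (simp add: degree_map_poly)
      hence "\<not> constant (poly (?m u))" by (simp add: constant_degree)
      then obtain z where z: "poly (?m u) z = 0"
        using fundamental_theorem_of_algebra by blast
      have "?m u dvd ?m (cyclotomic n)"
        using ud by (auto elim!: dvdE simp: map_poly_of_rat_mult)
      hence "poly (\<Prod>z\<in>primitive_roots_unity n. [:- z, 1:]) z = 0"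
        unfolding map_poly_cyclotomic[OF assms(1), symmetric] using z by (auto elim!: dvdE)
      hence "z \<in> primitive_roots_unity n"
        using finite_primitive_roots_unity[OF assms(1)] by (auto simp: poly_prod)
      hence "eval_ext (embed_at z) t_var \<in> evals n" by (simp add: evals_def)
      moreover have "eval_ext (embed_at z) t_var c = 0"
        by (simp add: eval_ext_embed_at u map_poly_pCons z)
      ultimately show False using not_dvd c(1) by blast
    qed
    thus "is_unit c" unfolding u using \<open>u \<noteq> 0\<close>
      by (simp add: is_unit_const_poly_iff is_unit_iff_degree)
  qed
  show ?thesis using 1 2 3 by (simp only: coprime_mult_right_iff)
qed

lemma ratfun_cong_of_has_values:
  assumes "n > 0" "has_values (evals n) (f - g) v" "\<And>h. h \<in> evals n \<Longrightarrow> v h = 0"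
  shows "ratfun_cong f g ([:cyclotomic n:] * (1 - a_var * q_var ^ n) * (a_var - q_var ^ n))"
proof -
  let ?P = "[:cyclotomic n:] * (1 - a_var * q_var ^ n) * (a_var - q_var ^ n)"
  obtain N D where ND: "D \<noteq> 0" "f - g = Fract N D"
      "\<And>h. h \<in> evals n \<Longrightarrow> h D \<noteq> 0 \<and> v h = h N / h D"
    using assms(2) unfolding has_values_def by blast
  have "coprime D ?P" using ND(3) by (intro evals_coprime[OF assms(1)]) blast
  moreover have "h N = 0" if "h \<in> evals n" for h
    using ND(3)[OF that] assms(3)[OF that] by auto
  hence "?P dvd N" by (rule evals_dvd[OF assms(1)])
  then obtain M where "N = ?P * M" by (rule dvdE)
  hence "f - g = to_fract ?P * Fract M D" using ND by (simp add: to_fract_def)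
  ultimately show ?thesis unfolding ratfun_cong_def using ND(1) by blast
qed

section \<open>The congruence\<close>

text \<open>Stated over any field, so that the same expression can be read in the fraction field of
  q and a and, after evaluation, in C(t).\<close>

definition lhs_sum :: "'a::field \<Rightarrow> 'a \<Rightarrow> nat \<Rightarrow> 'a" where
  "lhs_sum q a n = (\<Sum>k = 0..(n - 1) div 2.
       q_integer q (6 * k + 1) *
       ((q_pochhammer q (q ^ 4) k * q_pochhammer q (q ^ 2) k *
           (q_pochhammer (a * q) (q ^ 2) k * q_pochhammer (q / a) (q ^ 2) k)) /
        (q_pochhammer (q ^ 2) (q ^ 2) k * q_pochhammer (q ^ 4) (q ^ 4) k *
           (q_pochhammer (a * q ^ 4) (q ^ 4) k * q_pochhammer (q ^ 4 / a) (q ^ 4) k))) *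
       q ^ (k ^ 2 + k))"

definition rhs_value :: "'a::field \<Rightarrow> nat \<Rightarrow> 'a" where
  "rhs_value q n = (if n mod 4 = 1
     then q_pochhammer (q ^ 2) (q ^ 4) ((n - 1) div 4) /
            q_pochhammer (q ^ 4) (q ^ 4) ((n - 1) div 4) *
          q_integer q n * q powi ((1 - int n) div 4)
     else 0)"

lemma powi_quarter:
  fixes q :: "'a::field"
  assumes "n mod 4 = 1"
  shows "q powi ((1 - int n) div 4) = inverse (q ^ ((n - 1) div 4))"
proof -
  have n: "n = 4 * ((n - 1) div 4) + 1" using assms by presburger
  have "(1 - int n) div 4 = - int ((n - 1) div 4)"
    by (subst n) simp
  thus ?thesis by (simp add: power_int_minus)
qed

lemma lhs_sum_eq_cubic_sum:
  fixes q a :: "'a::field"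
  shows "lhs_sum q a n =
    (\<Sum>k<Suc ((n - 1) div 2). cubic_term q (q ^ 2) (a * q) (q / a) k) / (1 - q)"
proof -
  have eq: "(q ^ 2) ^ 2 = q ^ 4" "q * (a * q) * q ^ 2 = a * q ^ 4" "q * (q / a) * q ^ 2 = q ^ 4 / a"
    by (simp_all add: eval_nat_numeral)
  have "(q ^ 2) ^ (k * (k + 1) div 2) = q ^ (k ^ 2 + k)" for k
  proof -
    have "2 * (k * (k + 1) div 2) = k ^ 2 + k" by (simp add: power2_eq_square)
    thus ?thesis by (simp only: power_mult [symmetric])
  qed
  moreover have "q * (q ^ 2) ^ (3 * k) = q ^ (6 * k + 1)" for k
    by (simp add: power_mult [symmetric])
  ultimately show ?thesis
    unfolding lhs_sum_def sum_divide_distrib cubic_term_def cubic_weight_def eq q_integer_def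
    by (intro sum.cong) (auto simp: mult_ac)
qed

text \<open>For a = q^n and n = 2N + 1 the parameters are aq = p^(N+1) and q/a = p^(-N); for a =
  q^(-n) they are exchanged, and the summand is symmetric in them.\<close>

lemma lhs_sum_generic:
  fixes q a :: "'a::field"
  assumes q: "q \<noteq> 0" "\<And>i. i > 0 \<Longrightarrow> q ^ i \<noteq> 1"
    and n: "odd n" and a: "a = q ^ n \<or> a = inverse (q ^ n)"
  shows "lhs_sum q a n = rhs_value q n"
proof -
  define N where "N = (n - 1) div 2"
  have nN: "n = 2 * N + 1" unfolding N_def using n by presburger
  have e: "q ^ n * q = (q ^ 2) ^ (N + 1)" "inverse (q ^ n) * q = inverse ((q ^ 2) ^ N)"
    "q / q ^ n = inverse ((q ^ 2) ^ N)" "q / inverse (q ^ n) = (q ^ 2) ^ (N + 1)"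
    using q(1) unfolding nN by (simp_all add: field_simps power_mult power2_eq_square)
  define F where "F = (\<lambda>N. \<Sum>k<N + 1. cubic_term q (q ^ 2) (inverse ((q ^ 2) ^ N)) ((q ^ 2) ^ (N + 1)) k)"
  have F: "lhs_sum q a n = F N / (1 - q)"
    unfolding lhs_sum_eq_cubic_sum N_def[symmetric] F_def using a
    by (elim disjE) (simp_all only: e cubic_term_commute[of _ _ "(q ^ 2) ^ (N + 1)"] Suc_eq_plus1)
  show ?thesis
  proof (cases "n mod 4 = 1")
    case True
    define j where "j = (n - 1) div 4"
    have "N = 2 * j" "n = 4 * j + 1" using True nN unfolding j_def by presburger+
    thus ?thesis using sum_cubic_term_b(1)[OF q, of j]
      unfolding F rhs_value_def powi_quarter[OF True] j_def[symmetric] F_def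
      by (simp add: True q_integer_def)
  next
    case False
    have "N = 2 * (N div 2) + 1" using False nN by presburger
    then obtain j where "N = 2 * j + 1" ..
    thus ?thesis using sum_cubic_term_b(2)[OF q, of j] False
      unfolding F rhs_value_def F_def by simp
  qed
qed

text \<open>From q^n = 1 and n = 2N + 1 follows q = p^(-N) for p = q^2, so the sum vanishes by
  \<open>sum_cubic_term_A\<close>. The right side vanishes through its factor [n].\<close>

lemma lhs_sum_root_of_unity:
  fixes q a :: "'a::field"
  assumes n: "odd n" "n > 1" and q: "q ^ n = 1" "\<And>i. \<not> n dvd i \<Longrightarrow> q ^ i \<noteq> 1"
    and a: "a \<noteq> 0" "\<And>i j. a * q ^ i \<noteq> q ^ j"
  shows "lhs_sum q a n = rhs_value q n"
proof -
  define N where "N = (n - 1) div 2"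
  have nN: "n = 2 * N + 1" unfolding N_def using n by presburger
  have q0: "q \<noteq> 0" using q(1) n by (metis power_0_left zero_neq_one not_less_zero)
  have "q * (q ^ 2) ^ N = 1" using q(1) unfolding nN by (simp add: power_mult)
  hence A: "inverse ((q ^ 2) ^ N) = q" by (metis inverse_unique mult.commute)
  have "(\<Sum>k<Suc N. cubic_term (inverse ((q ^ 2) ^ N)) (q ^ 2) (a * q) (q / a) k) = 0"
  proof (rule sum_cubic_term_A)
    show "q ^ 2 = a * q * (q / a)" using a(1) by (simp add: power2_eq_square)
    show "q ^ 2 \<noteq> 0" using q0 by simp
    show "(q ^ 2) ^ (2 * i) \<noteq> 1" if "i \<in> {1..Suc N}" for i
    proof -
      \<comment> \<open>The exponent is 4i with 0 < i < n, and the odd number n does not divide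
        it.\<close>
      have "coprime n (2 ^ m)" for m using n(1) by simp
      moreover have "\<not> n dvd i" using that n nN by (auto dest: dvd_imp_le)
      ultimately have "\<not> n dvd 2 ^ 2 * i" by (simp only: coprime_dvd_mult_right_iff) simp
      moreover have "(q ^ 2) ^ (2 * i) = q ^ (2 ^ 2 * i)" by (simp flip: power_mult)
      ultimately show ?thesis using q(2) by metis
    qed
    show "a * q * (q ^ 2) ^ i \<noteq> (q ^ 2) ^ j" for i j
      using a(2)[of "Suc (2 * i)" "2 * j"] by (simp add: power_mult mult.assoc)
  qed
  thus ?thesis
    unfolding lhs_sum_eq_cubic_sum N_def[symmetric] A using q(1)
    by (simp add: rhs_value_def q_integer_def)
qed

section \<open>Images of q and a, and nonvanishing of the denominators\<close>

lemma has_values_q_integer: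
  assumes "has_values (evals n) q v" "\<And>h. h \<in> evals n \<Longrightarrow> v h \<noteq> 1"
  shows "has_values (evals n) (q_integer q m) (\<lambda>h. q_integer (v h) m)"
  unfolding q_integer_def using assms
  by (intro evals.has_values_divide evals.has_values_diff evals.has_values_1 evals.has_values_power) auto

text \<open>These alternatives are all that the evaluations of the sum use: either q is generic and
  a is one of its powers q^n, q^(-n), or q is a primitive n-th root of unity and a is independent of
  it.\<close>

lemma evals_cases:
  assumes "h \<in> evals n" "odd n"
  defines "Q \<equiv> h q_var" and "X \<equiv> h a_var"
  shows "Q \<noteq> 0" "X \<noteq> 0"
    and "((\<forall>i>0. Q ^ i \<noteq> 1) \<and> (X = Q ^ n \<or> X = inverse (Q ^ n))) \<or>
         (Q ^ n = 1 \<and> (\<forall>i. \<not> n dvd i \<longrightarrow> Q ^ i \<noteq> 1) \<and> (\<forall>i j. X * Q ^ i \<noteq> Q ^ j))"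
proof -
  have "n > 0" using assms(2) by (rule odd_pos)
  consider x where "h = eval_ext embed x" "x = t_var ^ n \<or> x = inverse (t_var ^ n)"
    | z where "z \<in> primitive_roots_unity n" "h = eval_ext (embed_at z) t_var"
    using assms(1) unfolding evals_def by blast
  hence "Q \<noteq> 0 \<and> X \<noteq> 0 \<and> (((\<forall>i>0. Q ^ i \<noteq> 1) \<and> (X = Q ^ n \<or> X = inverse (Q ^ n))) \<or>
         (Q ^ n = 1 \<and> (\<forall>i. \<not> n dvd i \<longrightarrow> Q ^ i \<noteq> 1) \<and> (\<forall>i j. X * Q ^ i \<noteq> Q ^ j)))"
  proof cases
    case 1
    thus ?thesis unfolding Q_def X_def
      using t_var_nonzero t_var_power_neq_1
      by (auto simp: eval_ext_q_var eval_ext_a_var unital_hom_embed embed_X)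
  next
    case 2
    have Q: "Q ^ i = to_fract [:z ^ i:]" for i unfolding Q_def 2(2)
      by (simp add: eval_ext_q_var unital_hom_embed_at embed_at_X unital_hom_power[OF unital_hom_const]
        flip: unital_hom_power[OF unital_hom_to_fract])
    have X: "X = to_fract [:0, 1:]" unfolding X_def 2(2)
      by (simp add: eval_ext_a_var unital_hom_embed_at t_var_def)
    have z: "z ^ n = 1" "\<And>k. 0 < k \<Longrightarrow> k < n \<Longrightarrow> z ^ k \<noteq> 1"
      using 2(1) by (auto simp: primitive_roots_unity_def)
    have z0: "z \<noteq> 0" using z(1) \<open>n > 0\<close> by (metis power_0_left zero_neq_one not_less_zero)
    have one: "to_fract [:c:] = 1 \<longleftrightarrow> c = 1" for c :: complex
      by (metis to_fract_1 to_fract_eq_iff one_pCons pCons_eq_iff)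
    have "Q ^ n = 1" using z(1) by (simp add: Q one)
    moreover have "Q ^ i \<noteq> 1" if "\<not> n dvd i" for i
    proof -
      have "z ^ i = z ^ (n * (i div n) + i mod n)" by simp
      also have "\<dots> = z ^ (i mod n)" by (simp only: power_add power_mult z(1)) simp
      also have "\<dots> \<noteq> 1" using z(2)[of "i mod n"] that \<open>n > 0\<close> by (auto simp: dvd_eq_mod_eq_0)
      finally show ?thesis by (simp add: Q one)
    qed
    \<comment> \<open>The left side has degree 1 in t, the right side is constant.\<close>
    moreover have "X * Q ^ i \<noteq> Q ^ j" for i j
    proof
      assume "X * Q ^ i = Q ^ j"
      hence "to_fract ([:0, 1:] * [:z ^ i:]) = to_fract [:z ^ j:]"
        by (simp only: X Q to_fract_mult)
      hence "[:0, 1:] * [:z ^ i:] = [:z ^ j:]" by (simp only: to_fract_eq_iff)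
      thus False using z0 by simp
    qed
    moreover have "Q \<noteq> 0" using Q[of 1] z0 by simp
    moreover have "X \<noteq> 0" by (simp add: X)
    ultimately show ?thesis by blast
  qed
  thus "Q \<noteq> 0" "X \<noteq> 0"
    and "((\<forall>i>0. Q ^ i \<noteq> 1) \<and> (X = Q ^ n \<or> X = inverse (Q ^ n))) \<or>
         (Q ^ n = 1 \<and> (\<forall>i. \<not> n dvd i \<longrightarrow> Q ^ i \<noteq> 1) \<and> (\<forall>i j. X * Q ^ i \<noteq> Q ^ j))"
    by blast+
qed

text \<open>For generic q the last two claims could fail only if 4i = n or 4i + n = 0, and n is odd
  and positive. For a root of unity they follow from the independence of a.\<close>

lemma evals_nonvanishing:
  assumes "h \<in> evals n" "odd n"
  shows "\<not> n dvd i \<Longrightarrow> h q_var ^ i \<noteq> 1" "h a_var * h q_var ^ (4 * i) \<noteq> 1" "h q_var ^ (4 * i) / h a_var \<noteq> 1"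
proof -
  define Q X where "Q = h q_var" and "X = h a_var"
  have Q0: "Q \<noteq> 0" and X0: "X \<noteq> 0" using evals_cases[OF assms] by (simp_all add: Q_def X_def)
  have "(\<not> n dvd i \<longrightarrow> Q ^ i \<noteq> 1) \<and> X * Q ^ (4 * i) \<noteq> 1 \<and> Q ^ (4 * i) \<noteq> X"
    using evals_cases(3)[OF assms, folded Q_def X_def]
  proof (elim disjE conjE)
    assume Q: "\<forall>i>0. Q ^ i \<noteq> 1" and X: "X = Q ^ n"
    have "X * Q ^ (4 * i) = Q ^ (n + 4 * i)" by (simp add: X power_add)
    moreover have "n + 4 * i > 0" using assms(2) by (auto intro: odd_pos)
    ultimately have "X * Q ^ (4 * i) \<noteq> 1" using Q by simp
    moreover have "Q ^ (4 * i) \<noteq> X"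
      using power_inj[of Q "4 * i" n] Q0 Q assms(2) unfolding X by auto
    moreover have "\<not> n dvd i \<longrightarrow> Q ^ i \<noteq> 1" using Q by (cases "i = 0") auto
    ultimately show ?thesis by blast
  next
    assume Q: "\<forall>i>0. Q ^ i \<noteq> 1" and X: "X = inverse (Q ^ n)"
    have "Q ^ (4 * i) * Q ^ n = Q ^ (n + 4 * i)" by (simp add: power_add)
    moreover have "n + 4 * i > 0" using assms(2) by (auto intro: odd_pos)
    ultimately have "Q ^ (4 * i) * Q ^ n \<noteq> 1" using Q by simp
    hence "Q ^ (4 * i) \<noteq> X" using Q0 unfolding X by (auto simp: field_simps)
    moreover have "X * Q ^ (4 * i) \<noteq> 1"
    proof
      assume "X * Q ^ (4 * i) = 1"
      hence "Q ^ (4 * i) = Q ^ n" using Q0 unfolding X by (simp add: field_simps)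
      thus False using power_inj[of Q "4 * i" n] Q0 Q assms(2) by auto
    qed
    moreover have "\<not> n dvd i \<longrightarrow> Q ^ i \<noteq> 1" using Q by (cases "i = 0") auto
    ultimately show ?thesis by blast
  next
    assume Q: "\<forall>i. \<not> n dvd i \<longrightarrow> Q ^ i \<noteq> 1" and X: "\<forall>i j. X * Q ^ i \<noteq> Q ^ j"
    thus ?thesis using X[rule_format, of "4 * i" 0] X[rule_format, of 0 "4 * i"] by auto
  qed
  thus "\<not> n dvd i \<Longrightarrow> h q_var ^ i \<noteq> 1" "h a_var * h q_var ^ (4 * i) \<noteq> 1" "h q_var ^ (4 * i) / h a_var \<noteq> 1"
    using X0 by (auto simp: Q_def X_def)
qed

lemma evals_pochhammer_nonzero:
  assumes "h \<in> evals n" "odd n" "k \<le> (n - 1) div 2"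
  shows "q_pochhammer (h q_var ^ 2) (h q_var ^ 2) k \<noteq> 0"
    and "q_pochhammer (h q_var ^ 4) (h q_var ^ 4) k \<noteq> 0"
    and "q_pochhammer (h a_var * h q_var ^ 4) (h q_var ^ 4) k \<noteq> 0"
    and "q_pochhammer (h q_var ^ 4 / h a_var) (h q_var ^ 4) k \<noteq> 0"
proof -
  have nd: "\<not> n dvd 2 ^ m * Suc i" if "i < k" for i m
  proof -
    have "coprime n (2 ^ m)" using assms(2) by simp
    moreover have "\<not> n dvd Suc i" using that assms(3) by (auto dest!: dvd_imp_le)
    ultimately show ?thesis by (simp only: coprime_dvd_mult_right_iff) simp
  qed
  show "q_pochhammer (h q_var ^ 2) (h q_var ^ 2) k \<noteq> 0"
  proof (rule q_pochhammer_nonzero)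
    fix i assume "i < k"
    thus "h q_var ^ 2 * (h q_var ^ 2) ^ i \<noteq> 1"
      using evals_nonvanishing(1)[OF assms(1,2) nd[of i 1]] by (simp add: power_mult power_add power2_eq_square mult.assoc)
  qed
  have 4: "h q_var ^ 4 * (h q_var ^ 4) ^ i = h q_var ^ (4 * Suc i)" for i
    by (simp add: power_mult power_add)
  show "q_pochhammer (h q_var ^ 4) (h q_var ^ 4) k \<noteq> 0"
  proof (rule q_pochhammer_nonzero)
    fix i assume "i < k"
    thus "h q_var ^ 4 * (h q_var ^ 4) ^ i \<noteq> 1"
      using evals_nonvanishing(1)[OF assms(1,2) nd[of i 2]] unfolding 4 by simp
  qed
  show "q_pochhammer (h a_var * h q_var ^ 4) (h q_var ^ 4) k \<noteq> 0"
    by (rule q_pochhammer_nonzero)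
       (use evals_nonvanishing(2)[OF assms(1,2)] in \<open>simp only: mult.assoc 4\<close>, simp)
  show "q_pochhammer (h q_var ^ 4 / h a_var) (h q_var ^ 4) k \<noteq> 0"
    by (rule q_pochhammer_nonzero)
       (use evals_nonvanishing(3)[OF assms(1,2)] in \<open>simp only: times_divide_eq_left 4\<close>, simp)
qed

theorem theorem2:
  fixes n :: nat and q a :: "rat poly poly fract"
  defines "q \<equiv> to_fract q_var" and "a \<equiv> to_fract a_var"
  assumes "n > 0" and "odd n"
  shows "ratfun_cong
    (\<Sum>k = 0..(n - 1) div 2.
       q_integer q (6 * k + 1) *
       ((q_pochhammer q (q ^ 4) k * q_pochhammer q (q ^ 2) k *
           (q_pochhammer (a * q) (q ^ 2) k * q_pochhammer (q / a) (q ^ 2) k)) /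
        (q_pochhammer (q ^ 2) (q ^ 2) k * q_pochhammer (q ^ 4) (q ^ 4) k *
           (q_pochhammer (a * q ^ 4) (q ^ 4) k * q_pochhammer (q ^ 4 / a) (q ^ 4) k))) *
       q ^ (k ^ 2 + k))
    (if n mod 4 = 1
     then q_pochhammer (q ^ 2) (q ^ 4) ((n - 1) div 4) /
            q_pochhammer (q ^ 4) (q ^ 4) ((n - 1) div 4) *
          q_integer q n * q powi ((1 - int n) div 4)
     else 0)
    ([:cyclotomic n:] * (1 - a_var * q_var ^ n) * (a_var - q_var ^ n))"
proof -
  have "ratfun_cong (lhs_sum q a n) (rhs_value q n)
      ([:cyclotomic n:] * (1 - a_var * q_var ^ n) * (a_var - q_var ^ n))"
  \<comment> \<open>For n = 1 the root of unity 1 would send the denominator 1 - q of the q-integers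
    to 0. This case is separate: both sides equal 1.\<close>
  proof (cases "n = 1")
    case True
    have "q \<noteq> 1"
    proof
      assume "q = 1"
      hence "to_fract q_var = to_fract 1" by (simp add: q_def)
      thus False by (simp add: q_var_def one_pCons)
    qed
    hence "lhs_sum q a n - rhs_value q n = 0"
      by (simp add: True lhs_sum_def rhs_value_def q_integer_def)
    thus ?thesis unfolding ratfun_cong_def
      by (intro exI[of _ 0] exI[of _ 1]) (simp add: Zero_fract_def[symmetric])
  next
    case False
    hence n: "n > 1" using assms(3) by simp
    have q: "has_values (evals n) q (\<lambda>h. h q_var)" and a: "has_values (evals n) a (\<lambda>h. h a_var)"
      unfolding q_def a_def by (rule evals.has_values_to_fract)+
    have q1: "h q_var \<noteq> 1" if "h \<in> evals n" for h
      using evals_nonvanishing(1)[OF that assms(4), of 1] n by auto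
    have lhs: "has_values (evals n) (lhs_sum q a n) (\<lambda>h. lhs_sum (h q_var) (h a_var) n)"
      unfolding lhs_sum_def
      by (intro evals.has_values_sum evals.has_values_mult evals.has_values_divide
          evals.has_values_q_pochhammer evals.has_values_power has_values_q_integer q a)
        (use q1 evals_cases(2)[OF _ assms(4)] evals_pochhammer_nonzero[OF _ assms(4)] in auto)
    have rhs: "has_values (evals n) (rhs_value q n) (\<lambda>h. rhs_value (h q_var) n)"
    proof (cases "n mod 4 = 1")
      case True
      have "(n - 1) div 4 \<le> (n - 1) div 2" by (intro div_le_mono2) auto
      thus ?thesis
        unfolding rhs_value_def powi_quarter[OF True] if_P[OF True]
        by (intro evals.has_values_mult evals.has_values_divide evals.has_values_inverse
          evals.has_values_q_pochhammer evals.has_values_power has_values_q_integer q)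
         (use q1 evals_cases(1)[OF _ assms(4)] evals_pochhammer_nonzero(2)[OF _ assms(4)] in auto)
    qed (simp add: rhs_value_def evals.has_values_0)
    \<comment> \<open>Each evaluation falls under the generic or the root-of-unity identity.\<close>
    have "lhs_sum (h q_var) (h a_var) n - rhs_value (h q_var) n = 0" if h: "h \<in> evals n" for h
      using evals_cases[OF h assms(4)] lhs_sum_generic[of "h q_var" n "h a_var"]
        lhs_sum_root_of_unity[of n "h q_var" "h a_var"] assms(4) n
      by auto
    from ratfun_cong_of_has_values[OF assms(3) evals.has_values_diff[OF lhs rhs] this]
    show ?thesis .
  qed
  thus ?thesis unfolding lhs_sum_def rhs_value_def .
qed

end
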